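(* Let $\Gamma$ be a bipartite surface graph on a compact oriented surface $S$. As $Z$ runs over the (oriented) zig-zag loops of $\Gamma$, the functions $W_Z$ generate the center of the Poisson algebra $\mathcal{O}(\mathcal{L}_\Gamma)$ of regular functions on $\mathcal{L}_\Gamma$. One has $\prod_Z W_Z=1$ (product over all zig-zag loops), and this is the only relation between the functions $W_Z$.
   Context: A bipartite surface graph $\Gamma\subset S$ is a finite graph embedded in a compact oriented surface $S$ such that all faces (components of $S\setminus\Gamma$) are contractible, with vertices colored black and white so that each edge has one black and one white endpoint. $\mathcal{L}_\Gamma$ is the moduli space of complex line bundles with connection on $\Gamma$ (a one-dimensional space at each vertex, an isomorphism for each oriented edge, inverse for the reversed edge), modulo isomorphism; $\mathcal{L}_\Gamma\cong \mathrm{Hom}(H_1(\Gamma,\mathbb{Z}),\mathbb{C}^* )$. For an oriented loop $L$ on $\Gamma$, $W_L$ is the function on $\mathcal{L}_\Gamma$ given by the monodromy along $L$. Poisson structure: the orientation of $S$ gives a cyclic order of the edges at each vertex of $\Gamma$ (a ribbon graph structure). Reversing the cyclic order at all white vertices gives a new ribbon graph $\widehat\Gamma$ with the same underlying graph; let $\widehat S_w$ be the corresponding oriented surface with boundary, and let $\varepsilon$ be the intersection pairing on $H_1(\widehat S_w,\mathbb{Z})=H_1(\Gamma,\mathbb{Z})$. The Poisson bracket is determined by $\{W_{L_1},W_{L_2}\}=\varepsilon(L_1,L_2)W_{L_1}W_{L_2}$ and the Leibniz rule. A zig-zag path is an oriented path on $\Gamma$ that turns maximally left at white vertices and maximally right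 at black vertices; it closes up to a zig-zag loop.
   Formalization: The graph Γ (equivalently, given contractible faces, the surface S) is assumed connected; on a disconnected surface the product of the W_Z over each component is 1, so the stated relation would not be the only one. *)

theory Defs
  imports
    "HOL-Complex_Analysis.Complex_Analysis"
    "HOL-Algebra.Module"
    "HOL-Algebra.Generated_Rings"
    "HOL-Combinatorics.Cycles"
    "HOL-Library.Poly_Mapping"
begin

section \<open>Compact oriented surfaces\<close>

type_synonym 's chart = "'s set \<times> ('s \<Rightarrow> complex)"

definition surface_chart :: "'s topology \<Rightarrow> 's chart \<Rightarrow> bool" where
  "surface_chart S = (\<lambda>(U, \<phi>). openin S U \<and> open (\<phi> ` U) \<and>
     homeomorphic_map (subtopology S U) (top_of_set (\<phi> ` U)) \<phi>)"

text \<open>A homeomorphism between open subsets of the plane preserves the orientation iff it maps small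
  positively oriented circles around any point \<open>z\<close> to loops of index 1 around the image of \<open>z\<close>.\<close>

definition orientation_preserving_on :: "complex set \<Rightarrow> (complex \<Rightarrow> complex) \<Rightarrow> bool" where
  "orientation_preserving_on \<Omega> h \<longleftrightarrow>
     (\<forall>z\<in>\<Omega>. \<forall>\<^sub>F r in at_right 0. winding_number (h \<circ> circlepath z r) (h z) = 1)"

definition orientation_compatible :: "'s chart \<Rightarrow> 's chart \<Rightarrow> bool" where
  "orientation_compatible = (\<lambda>(U, \<phi>) (V, \<psi>).
     orientation_preserving_on (\<phi> ` (U \<inter> V)) (\<psi> \<circ> inv_into U \<phi>))"

text \<open>A surface has no boundary here (a connected compact surface with boundary is never cut into
  contractible pieces by a nonempty graph in its interior); its orientation is given by an oriented atlas.
  Second countability follows from compactness.\<close>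

definition compact_oriented_surface :: "'s topology \<Rightarrow> 's chart set \<Rightarrow> bool" where
  "compact_oriented_surface S \<A> \<longleftrightarrow>
     compact_space S \<and> Hausdorff_space S \<and> topspace S = (\<Union>(U, \<phi>)\<in>\<A>. U) \<and>
     (\<forall>c\<in>\<A>. surface_chart S c) \<and> (\<forall>c\<in>\<A>. \<forall>c'\<in>\<A>. orientation_compatible c c')"

definition positive_chart :: "'s topology \<Rightarrow> 's chart set \<Rightarrow> 's chart \<Rightarrow> bool" where
  "positive_chart S \<A> c \<longleftrightarrow> surface_chart S c \<and> (\<forall>c'\<in>\<A>. orientation_compatible c c')"


section \<open>Bipartite surface graphs\<close>

text \<open>Vertices are points of the surface. The edge \<open>e\<close> is the arc \<open>curve e\<close>, parametrised by the unit
  interval from its black endpoint to its white endpoint; multiple edges are allowed.\<close>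

record ('s, 'e) bipartite_graph =
  black :: "'s set"
  white :: "'s set"
  edges :: "'e set"
  curve :: "'e \<Rightarrow> real \<Rightarrow> 's"

definition vertices :: "('s, 'e) bipartite_graph \<Rightarrow> 's set" where
  "vertices \<Gamma> = black \<Gamma> \<union> white \<Gamma>"

definition black_end :: "('s, 'e) bipartite_graph \<Rightarrow> 'e \<Rightarrow> 's" where
  "black_end \<Gamma> e = curve \<Gamma> e 0"

definition white_end :: "('s, 'e) bipartite_graph \<Rightarrow> 'e \<Rightarrow> 's" where
  "white_end \<Gamma> e = curve \<Gamma> e 1"

definition edges_at :: "('s, 'e) bipartite_graph \<Rightarrow> 's \<Rightarrow> 'e set" where
  "edges_at \<Gamma> v = {e \<in> edges \<Gamma>. black_end \<Gamma> e = v \<or> white_end \<Gamma> e = v}"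

definition graph_support :: "('s, 'e) bipartite_graph \<Rightarrow> 's set" where
  "graph_support \<Gamma> = vertices \<Gamma> \<union> (\<Union>e\<in>edges \<Gamma>. curve \<Gamma> e ` {0..1})"

definition faces :: "'s topology \<Rightarrow> ('s, 'e) bipartite_graph \<Rightarrow> 's set set" where
  "faces S \<Gamma> = connected_components_of (subtopology S (topspace S - graph_support \<Gamma>))"

text \<open>\<open>es\<close> lists the edges at \<open>v\<close> in counterclockwise order: in some positive chart centred at \<open>v\<close> these
  edges are the radii of the unit disc with increasing arguments in the order of the list. Only
  the cyclic order is meaningful, the first element of the list being arbitrary.\<close>

definition ccw_order ::
    "'s topology \<Rightarrow> 's chart set \<Rightarrow> ('s, 'e) bipartite_graph \<Rightarrow> 's \<Rightarrow> 'e list \<Rightarrow> bool" where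
  "ccw_order S \<A> \<Gamma> v es \<longleftrightarrow> distinct es \<and> set es = edges_at \<Gamma> v \<and>
     (\<exists>U \<phi> \<theta>. positive_chart S \<A> (U, \<phi>) \<and> v \<in> U \<and> \<phi> v = 0 \<and> \<phi> ` U = ball 0 1 \<and>
        (\<forall>i<length es. 0 \<le> \<theta> i \<and> \<theta> i < 2 * pi) \<and> strict_mono_on {..<length es} \<theta> \<and>
        (\<forall>i<length es. \<phi> ` (U \<inter> curve \<Gamma> (es ! i) ` {0..1}) =
           {complex_of_real t * cis (\<theta> i) | t. 0 \<le> t \<and> t < 1}))"

definition ccw_edges ::
    "'s topology \<Rightarrow> 's chart set \<Rightarrow> ('s, 'e) bipartite_graph \<Rightarrow> 's \<Rightarrow> 'e list" where
  "ccw_edges S \<A> \<Gamma> v = (SOME es. ccw_order S \<A> \<Gamma> v es)"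

text \<open>The last conjunct says that the edges are tame at the vertices; by the Schoenflies theorem it holds
  for every topological embedding of a graph into a surface.\<close>

definition bipartite_surface_graph ::
    "'s topology \<Rightarrow> 's chart set \<Rightarrow> ('s, 'e) bipartite_graph \<Rightarrow> bool" where
  "bipartite_surface_graph S \<A> \<Gamma> \<longleftrightarrow>
     finite (vertices \<Gamma>) \<and> finite (edges \<Gamma>) \<and>
     vertices \<Gamma> \<subseteq> topspace S \<and> black \<Gamma> \<inter> white \<Gamma> = {} \<and>
     (\<forall>e\<in>edges \<Gamma>. pathin S (curve \<Gamma> e) \<and> inj_on (curve \<Gamma> e) {0..1} \<and>
        black_end \<Gamma> e \<in> black \<Gamma> \<and> white_end \<Gamma> e \<in> white \<Gamma> \<and>
        curve \<Gamma> e ` {0<..<1} \<inter> vertices \<Gamma> = {}) \<and>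
     (\<forall>e\<in>edges \<Gamma>. \<forall>f\<in>edges \<Gamma>. e \<noteq> f \<longrightarrow>
        curve \<Gamma> e ` {0<..<1} \<inter> curve \<Gamma> f ` {0<..<1} = {}) \<and>
     (\<forall>F\<in>faces S \<Gamma>. contractible_space (subtopology S F)) \<and>
     (\<forall>v\<in>vertices \<Gamma>. \<exists>es. ccw_order S \<A> \<Gamma> v es)"

text \<open>For a graph with contractible faces this is equivalent to the connectedness of the surface.\<close>

definition connected_graph :: "('s, 'e) bipartite_graph \<Rightarrow> bool" where
  "connected_graph \<Gamma> \<longleftrightarrow>
     (let adj = {(black_end \<Gamma> e, white_end \<Gamma> e) | e. e \<in> edges \<Gamma>}
      in \<forall>u\<in>vertices \<Gamma>. \<forall>v\<in>vertices \<Gamma>. (u, v) \<in> (adj \<union> adj\<inverse>)\<^sup>*)"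


section \<open>Oriented edges, loops and zig-zag loops\<close>

text \<open>\<open>(e, True)\<close> is the edge \<open>e\<close> oriented from black to white, \<open>(e, False)\<close> is its reverse.\<close>

type_synonym 'e oriented_edge = "'e \<times> bool"

definition oriented_edges :: "('s, 'e) bipartite_graph \<Rightarrow> 'e oriented_edge set" where
  "oriented_edges \<Gamma> = edges \<Gamma> \<times> UNIV"

definition reverse_edge :: "'e oriented_edge \<Rightarrow> 'e oriented_edge" where
  "reverse_edge d = (fst d, \<not> snd d)"

definition source :: "('s, 'e) bipartite_graph \<Rightarrow> 'e oriented_edge \<Rightarrow> 's" where
  "source \<Gamma> d = (if snd d then black_end \<Gamma> (fst d) else white_end \<Gamma> (fst d))"

definition target :: "('s, 'e) bipartite_graph \<Rightarrow> 'e oriented_edge \<Rightarrow> 's" where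
  "target \<Gamma> d = source \<Gamma> (reverse_edge d)"

definition oriented_loop :: "('s, 'e) bipartite_graph \<Rightarrow> 'e oriented_edge list \<Rightarrow> bool" where
  "oriented_loop \<Gamma> L \<longleftrightarrow> set L \<subseteq> oriented_edges \<Gamma> \<and>
     (\<forall>i<length L. target \<Gamma> (L ! i) = source \<Gamma> (L ! (Suc i mod length L)))"

text \<open>A ribbon graph structure is given by a list \<open>rib v\<close> of the edges at each vertex \<open>v\<close>, read as a cyclic
  order; for \<open>ccw_edges\<close> this order is counterclockwise. \<open>cycle_of_list (rib v)\<close> sends an edge at \<open>v\<close> to the next
  one in this order. An oriented edge arriving at \<open>v\<close> along \<open>e\<close> turns maximally right by leaving along
  the edge following \<open>e\<close> counterclockwise, and maximally left by leaving along the edge following \<open>e\<close>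
  clockwise.\<close>

definition turn_right ::
    "('s, 'e) bipartite_graph \<Rightarrow> ('s \<Rightarrow> 'e list) \<Rightarrow> 'e oriented_edge \<Rightarrow> 'e oriented_edge" where
  "turn_right \<Gamma> rib d = (cycle_of_list (rib (target \<Gamma> d)) (fst d), \<not> snd d)"

definition turn_left ::
    "('s, 'e) bipartite_graph \<Rightarrow> ('s \<Rightarrow> 'e list) \<Rightarrow> 'e oriented_edge \<Rightarrow> 'e oriented_edge" where
  "turn_left \<Gamma> rib d = (cycle_of_list (rev (rib (target \<Gamma> d))) (fst d), \<not> snd d)"

definition zigzag_next ::
    "('s, 'e) bipartite_graph \<Rightarrow> ('s \<Rightarrow> 'e list) \<Rightarrow> 'e oriented_edge \<Rightarrow> 'e oriented_edge" where
  "zigzag_next \<Gamma> rib d =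
     (if target \<Gamma> d \<in> white \<Gamma> then turn_left \<Gamma> rib d else turn_right \<Gamma> rib d)"

text \<open>Distinctness expresses that the zig-zag loop is traversed only once.\<close>

definition zigzag_path ::
    "('s, 'e) bipartite_graph \<Rightarrow> ('s \<Rightarrow> 'e list) \<Rightarrow> 'e oriented_edge list \<Rightarrow> bool" where
  "zigzag_path \<Gamma> rib L \<longleftrightarrow> L \<noteq> [] \<and> distinct L \<and> set L \<subseteq> oriented_edges \<Gamma> \<and>
     (\<forall>i<length L. L ! (Suc i mod length L) = zigzag_next \<Gamma> rib (L ! i))"

text \<open>Zig-zag loops have no base point. As each oriented edge determines its successor, a zig-zag loop is
  recorded by the set of oriented edges it traverses.\<close>

definition zigzag_loops ::
    "('s, 'e) bipartite_graph \<Rightarrow> ('s \<Rightarrow> 'e list) \<Rightarrow> 'e oriented_edge set set" where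
  "zigzag_loops \<Gamma> rib = {set L | L. zigzag_path \<Gamma> rib L}"


section \<open>The intersection pairing of a ribbon graph\<close>

definition reverse_at_white ::
    "('s, 'e) bipartite_graph \<Rightarrow> ('s \<Rightarrow> 'e list) \<Rightarrow> 's \<Rightarrow> 'e list" where
  "reverse_at_white \<Gamma> rib v = (if v \<in> white \<Gamma> then rev (rib v) else rib v)"

text \<open>The homology class of a loop, as a cellular 1-cycle: the coefficient of each edge, oriented from
  black to white.\<close>

definition loop_class :: "'e oriented_edge list \<Rightarrow> 'e \<Rightarrow> int" where
  "loop_class L e = int (count_list L (e, True)) - int (count_list L (e, False))"

text \<open>Twice the local intersection number at a vertex with cyclic order \<open>es\<close>, for 1-cycles with outflows
  \<open>x e\<close>, \<open>y e\<close> along the edges. Since the outflows at a vertex add up to 0, it does not depend on where the cyclic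
  order is cut open. Two strands crossing at the vertex, the second one from right to left of the first one,
  contribute 2; strands that share an edge contribute the halves of a crossing
  at both ends of the shared part.
  At a white vertex the outflows are \<open>- x e\<close> and \<open>- y e\<close>, so the formula is the same at all vertices.\<close>

definition local_intersection :: "'e list \<Rightarrow> ('e \<Rightarrow> int) \<Rightarrow> ('e \<Rightarrow> int) \<Rightarrow> int" where
  "local_intersection es x y =
     (\<Sum>j<length es. \<Sum>i<j. x (es ! i) * y (es ! j) - x (es ! j) * y (es ! i))"

definition intersection_number ::
    "('s, 'e) bipartite_graph \<Rightarrow> ('s \<Rightarrow> 'e list) \<Rightarrow> ('e \<Rightarrow> int) \<Rightarrow> ('e \<Rightarrow> int) \<Rightarrow> rat" where
  "intersection_number \<Gamma> rib x y =
     (\<Sum>v\<in>vertices \<Gamma>. of_int (local_intersection (rib v) x y)) / 2"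


section \<open>The moduli space of line bundles with connection and its regular functions\<close>

text \<open>After choosing a basis vector of the line at each vertex, a line bundle with connection is a family of
  nonzero numbers, one for each oriented edge. Isomorphisms become gauge transformations.\<close>

definition connections :: "('s, 'e) bipartite_graph \<Rightarrow> ('e oriented_edge \<Rightarrow> complex) set" where
  "connections \<Gamma> = {\<Phi> \<in> oriented_edges \<Gamma> \<rightarrow>\<^sub>E UNIV - {0}.
     \<forall>d\<in>oriented_edges \<Gamma>. \<Phi> (reverse_edge d) = inverse (\<Phi> d)}"

definition gauge_equivalence ::
    "('s, 'e) bipartite_graph \<Rightarrow> ('e oriented_edge \<Rightarrow> complex) rel" where
  "gauge_equivalence \<Gamma> = {(\<Phi>, \<Psi>). \<Phi> \<in> connections \<Gamma> \<and> \<Psi> \<in> connections \<Gamma> \<and>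
     (\<exists>g. (\<forall>v\<in>vertices \<Gamma>. g v \<noteq> 0) \<and>
        (\<forall>d\<in>oriented_edges \<Gamma>. \<Psi> d = g (target \<Gamma> d) * \<Phi> d / g (source \<Gamma> d)))}"

type_synonym 'e line_bundle_class = "('e oriented_edge \<Rightarrow> complex) set"

definition line_bundles :: "('s, 'e) bipartite_graph \<Rightarrow> 'e line_bundle_class set" where
  "line_bundles \<Gamma> = connections \<Gamma> // gauge_equivalence \<Gamma>"

definition monodromy ::
    "('s, 'e) bipartite_graph \<Rightarrow> 'e oriented_edge list \<Rightarrow> 'e line_bundle_class \<Rightarrow> complex" where
  "monodromy \<Gamma> L =
     (\<lambda>l\<in>line_bundles \<Gamma>. the_elem ((\<lambda>\<Phi>. prod_list (map \<Phi> L)) ` l))"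

definition zigzag_monodromy ::
    "('s, 'e) bipartite_graph \<Rightarrow> ('s \<Rightarrow> 'e list) \<Rightarrow> 'e oriented_edge set \<Rightarrow>
     'e line_bundle_class \<Rightarrow> complex" where
  "zigzag_monodromy \<Gamma> rib Z = monodromy \<Gamma> (SOME L. zigzag_path \<Gamma> rib L \<and> set L = Z)"

text \<open>The moduli space is the quotient of the torus of connections by the torus of gauge transformations, so a
  function on it is regular iff it is a Laurent polynomial in the parallel transports along the edges.\<close>

definition regular_function ::
    "('s, 'e) bipartite_graph \<Rightarrow> ('e line_bundle_class \<Rightarrow> complex) \<Rightarrow> bool" where
  "regular_function \<Gamma> f \<longleftrightarrow> f \<in> extensional (line_bundles \<Gamma>) \<and>
     (\<exists>(M :: ('e \<Rightarrow> int) set) a. finite M \<and>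
        (\<forall>\<Phi>\<in>connections \<Gamma>. f (gauge_equivalence \<Gamma> `` {\<Phi>}) =
           (\<Sum>m\<in>M. a m * (\<Prod>e\<in>edges \<Gamma>. \<Phi> (e, True) powi m e))))"

definition regular_functions ::
    "('s, 'e) bipartite_graph \<Rightarrow> (complex, 'e line_bundle_class \<Rightarrow> complex) module" where
  "regular_functions \<Gamma> = \<lparr>
     carrier = {f. regular_function \<Gamma> f},
     monoid.mult = (\<lambda>f g. \<lambda>l\<in>line_bundles \<Gamma>. f l * g l),
     one = (\<lambda>l\<in>line_bundles \<Gamma>. 1),
     zero = (\<lambda>l\<in>line_bundles \<Gamma>. 0),
     add = (\<lambda>f g. \<lambda>l\<in>line_bundles \<Gamma>. f l + g l),
     smult = (\<lambda>a f. \<lambda>l\<in>line_bundles \<Gamma>. a * f l)\<rparr>"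


section \<open>Poisson brackets\<close>

definition poisson_bracket :: "(complex, 'f) module \<Rightarrow> ('f \<Rightarrow> 'f \<Rightarrow> 'f) \<Rightarrow> bool" where
  "poisson_bracket A B \<longleftrightarrow>
     (\<forall>f\<in>carrier A. \<forall>g\<in>carrier A. B f g \<in> carrier A) \<and>
     (\<forall>a. \<forall>f\<in>carrier A. \<forall>g\<in>carrier A. \<forall>h\<in>carrier A.
        B (a \<odot>\<^bsub>A\<^esub> f \<oplus>\<^bsub>A\<^esub> g) h = a \<odot>\<^bsub>A\<^esub> B f h \<oplus>\<^bsub>A\<^esub> B g h) \<and>
     (\<forall>f\<in>carrier A. \<forall>g\<in>carrier A. B f g \<oplus>\<^bsub>A\<^esub> B g f = \<zero>\<^bsub>A\<^esub>) \<and>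
     (\<forall>f\<in>carrier A. \<forall>g\<in>carrier A. \<forall>h\<in>carrier A.
        B f (B g h) \<oplus>\<^bsub>A\<^esub> B g (B h f) \<oplus>\<^bsub>A\<^esub> B h (B f g) = \<zero>\<^bsub>A\<^esub>) \<and>
     (\<forall>f\<in>carrier A. \<forall>g\<in>carrier A. \<forall>h\<in>carrier A.
        B f (g \<otimes>\<^bsub>A\<^esub> h) = B f g \<otimes>\<^bsub>A\<^esub> h \<oplus>\<^bsub>A\<^esub> g \<otimes>\<^bsub>A\<^esub> B f h)"

definition poisson_center :: "(complex, 'f) module \<Rightarrow> ('f \<Rightarrow> 'f \<Rightarrow> 'f) \<Rightarrow> 'f set" where
  "poisson_center A B = {f \<in> carrier A. \<forall>g\<in>carrier A. B f g = \<zero>\<^bsub>A\<^esub>}"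

definition generated_subalgebra :: "(complex, 'f) module \<Rightarrow> 'f set \<Rightarrow> 'f set" where
  "generated_subalgebra A X = generate_ring A (range (\<lambda>a. a \<odot>\<^bsub>A\<^esub> \<one>\<^bsub>A\<^esub>) \<union> X)"

definition surface_graph_bracket ::
    "('s, 'e) bipartite_graph \<Rightarrow> ('s \<Rightarrow> 'e list) \<Rightarrow>
     (('e line_bundle_class \<Rightarrow> complex) \<Rightarrow> ('e line_bundle_class \<Rightarrow> complex) \<Rightarrow>
      ('e line_bundle_class \<Rightarrow> complex)) \<Rightarrow> bool" where
  "surface_graph_bracket \<Gamma> rib B \<longleftrightarrow> poisson_bracket (regular_functions \<Gamma>) B \<and>
     (\<forall>L\<^sub>1 L\<^sub>2. oriented_loop \<Gamma> L\<^sub>1 \<and> oriented_loop \<Gamma> L\<^sub>2 \<longrightarrow>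
        B (monodromy \<Gamma> L\<^sub>1) (monodromy \<Gamma> L\<^sub>2) =
          of_rat (intersection_number \<Gamma> (reverse_at_white \<Gamma> rib) (loop_class L\<^sub>1) (loop_class L\<^sub>2))
          \<odot>\<^bsub>regular_functions \<Gamma>\<^esub>
          (monodromy \<Gamma> L\<^sub>1 \<otimes>\<^bsub>regular_functions \<Gamma>\<^esub> monodromy \<Gamma> L\<^sub>2))"


section \<open>Polynomials in several variables\<close>

type_synonym 'z polynomial = "('z \<Rightarrow>\<^sub>0 nat) \<Rightarrow>\<^sub>0 complex"

definition polynomials_in :: "'z set \<Rightarrow> 'z polynomial set" where
  "polynomials_in X = {P. \<forall>m\<in>Poly_Mapping.keys P. Poly_Mapping.keys m \<subseteq> X}"

definition variable :: "'z \<Rightarrow> 'z polynomial" where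
  "variable z = Poly_Mapping.single (Poly_Mapping.single z 1) 1"

definition evaluate :: "('z \<Rightarrow> complex) \<Rightarrow> 'z polynomial \<Rightarrow> complex" where
  "evaluate w P = (\<Sum>m\<in>Poly_Mapping.keys P. Poly_Mapping.lookup P m *
     (\<Prod>z\<in>Poly_Mapping.keys m. w z ^ Poly_Mapping.lookup m z))"

end

theory Submission
  imports Defs
begin

text \<open>The Poisson algebra is the group algebra of \<open>H\<^sub>1(\<Gamma>, \<int>)\<close>: the monodromies \<open>\<W> m\<close>, one for each integral cycle \<open>m\<close>,
  form a basis of the regular functions, they multiply by adding the cycles, and
  \<open>{\<W> m, \<W> m'} = \<epsilon>(m, m') \<W> (m + m')\<close>. All three assertions thereby become statements about the homology classes
  \<open>[Z]\<close> of the zig-zag loops.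

  That the \<open>\<W> m\<close> are a basis is Dedekind's independence of characters, applied to the torus of connections: a Laurent
  polynomial on this torus is gauge invariant only if all its exponents are cycles (\<open>regular_function_cases\<close>,
  \<open>class_characters_independent\<close>). The bracket of two basis elements is given by the pairing because in a connected
  graph every integral cycle is the class of a single closed walk (\<open>cycle_is_loop_class\<close>, \<open>bracket_characters\<close>). As the
  shifts \<open>m + m'\<close> of distinct \<open>m\<close> by one \<open>m'\<close> are distinct, a function is central iff all its exponents
  lie in the radical of \<open>\<epsilon>\<close>.

  After reversing the cyclic orders at the white vertices, a zig-zag path simply leaves each vertex along the edge that
  follows its arriving edge, so the zig-zag loops are the boundary components of the ribbon surface with
  the new cyclic orders. The radical of its intersection pairing is spanned by them, as the following discrete version of
  integration along the boundary shows. A cycle \<open>x\<close>, restricted to the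
  edges at a vertex \<open>v\<close>, has an antiderivative \<open>A v\<close> along the cyclic order, and summation by parts gives
  \<open>\<epsilon>(x, y) = \<Sum>e. (A (b e) e + A (w e) e + x e) * y e\<close>, where \<open>b e\<close> and \<open>w e\<close> are the ends of \<open>e\<close>
  (\<open>pairing_antiderivative\<close>). This vanishes for all cycles \<open>y\<close> iff the
  coefficient of \<open>y e\<close> is a sum of potentials at the two ends of \<open>e\<close>. Subtracting the potentials from the antiderivatives
  turns them into one function \<open>\<nu>\<close> of oriented edges that is constant along zig-zag paths and satisfies
  \<open>x e = \<nu> (e, True) - \<nu> (e, False)\<close>; this says that \<open>x\<close> is the combination of the classes \<open>[Z]\<close> with coefficients the
  values of \<open>\<nu>\<close>. The computation can be read backwards
  (\<open>radical_is_zigzag_sum\<close>, \<open>zigzag_sum_radical\<close>).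

  Each edge is traversed once in each direction by the zig-zag loops, so the sum of all \<open>[Z]\<close> is zero. Conversely, if
  \<open>\<Sum>Z. n Z * [Z] = 0\<close>, then the zig-zag loops on both sides of an edge have the same coefficient, and so have those
  meeting at a vertex; as the graph is connected, \<open>n\<close> is constant (\<open>zigzag_sum_eq_zero\<close>). This single relation allows
  negative powers of the functions \<open>W\<^sub>Z\<close> to be replaced by nonnegative ones, whence they generate the
  center (\<open>center_eq_zigzag_algebra\<close>), and it shows that two monomials in the
  \<open>W\<^sub>Z\<close> agree iff they differ by a power of the product of all variables, from which every polynomial relation follows
  (\<open>relation_is_product_relation\<close>).\<close>

section \<open>Cyclic sequences\<close>

lemma cycle_of_list_nth:
  assumes "distinct es" "i < length es"
  shows "cycle_of_list es (es ! i) = es ! (Suc i mod length es)"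
proof -
  have "map (cycle_of_list es) es ! i = rotate 1 es ! i"
    using cyclic_rotation[OF assms(1), of 1] by simp
  then show ?thesis
    using assms(2) by (simp add: nth_rotate1)
qed

lemma exists_function_on_distinct_list:
  assumes "distinct es"
  shows "\<exists>F. \<forall>i<length es. F (es ! i) = f i"
proof -
  have "inj_on ((!) es) {..<length es}"
    using assms by (auto intro: inj_onI simp: nth_eq_iff_index_eq)
  then have "\<forall>i<length es. f (inv_into {..<length es} ((!) es) (es ! i)) = f i"
    by (simp add: inv_into_f_f)
  then show ?thesis
    by (intro exI[of _ "\<lambda>e. f (inv_into {..<length es} ((!) es) e)"])
qed

lemma sum_list_index:
  assumes "distinct es"
  shows "(\<Sum>e\<in>set es. f e) = (\<Sum>i<length es. f (es ! i))"
proof -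
  have "(\<Sum>e\<in>set es. f e) = sum_list (map f es)"
    using assms by (simp add: sum_list_distinct_conv_sum_set)
  also have "\<dots> = (\<Sum>i<length es. f (es ! i))"
    by (simp add: sum_list_sum_nth atLeast0LessThan)
  finally show ?thesis .
qed

text \<open>Summation by parts. The boundary term on the right vanishes when one of the two sequences adds up to zero.\<close>

lemma alternating_double_sum:
  fixes x y :: "nat \<Rightarrow> int"
  shows "(\<Sum>j<n. \<Sum>i<j. x i * y j - x j * y i) =
    (\<Sum>j<n. (2 * sum x {..<j} + x j) * y j) - sum x {..<n} * sum y {..<n}"
proof (induction n)
  case (Suc n)
  have "(\<Sum>i<n. x i * y n - x n * y i) = sum x {..<n} * y n - x n * sum y {..<n}"
    by (simp add: sum_subtractf sum_distrib_left sum_distrib_right)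
  with Suc show ?case
    by (simp add: algebra_simps)
qed simp

text \<open>Partial sums along the list; at the end of the list they return to the initial value because the total is zero.\<close>

lemma cyclic_antiderivative_exists:
  fixes x :: "'e \<Rightarrow> int"
  assumes "distinct es" and "(\<Sum>e\<in>set es. x e) = 0"
  shows "\<exists>A. \<forall>e\<in>set es. A (cycle_of_list es e) = A e + x e"
proof -
  obtain A where A: "\<forall>i<length es. A (es ! i) = (\<Sum>k<i. x (es ! k))"
    using exists_function_on_distinct_list[OF assms(1), of "\<lambda>i. \<Sum>k<i. x (es ! k)"] by blast
  have "A (cycle_of_list es (es ! i)) = A (es ! i) + x (es ! i)" if i: "i < length es" for i
  proof (cases "Suc i = length es")
    case True
    then have "(\<Sum>k<i. x (es ! k)) + x (es ! i) = 0"
      using assms sum_list_index[OF assms(1), of x] by (metis sum.lessThan_Suc)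
    moreover have "A (es ! 0) = 0"
      using A i by (cases es) auto
    ultimately show ?thesis
      using True A i by (simp add: cycle_of_list_nth[OF assms(1)])
  next
    case False
    then show ?thesis
      using A i by (simp add: cycle_of_list_nth[OF assms(1)])
  qed
  then show ?thesis
    by (intro exI[of _ A]) (auto simp: in_set_conv_nth)
qed

lemma cyclic_antiderivative_sum:
  fixes x :: "'e \<Rightarrow> int"
  assumes "distinct es" and "\<And>e. e \<in> set es \<Longrightarrow> A (cycle_of_list es e) = A e + x e"
  shows "(\<Sum>e\<in>set es. x e) = 0"
proof -
  have "(\<Sum>e\<in>set es. A (cycle_of_list es e)) = (\<Sum>e\<in>set es. A e)"
    by (rule sum.reindex_bij_betw) (rule permutes_imp_bij[OF cycle_permutes])
  then show ?thesis
    using assms(2) by (simp add: sum.distrib)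
qed

text \<open>The partial sums of \<open>x\<close> are \<open>A\<close> up to an additive constant, which contributes a multiple of the
  sum of \<open>y\<close>, that is, nothing. The result refers to the cyclic order only, not to where it is cut
  open, and it is visibly a linear functional of \<open>y\<close>.\<close>

lemma local_intersection_antiderivative:
  assumes "distinct es" and "\<And>e. e \<in> set es \<Longrightarrow> A (cycle_of_list es e) = A e + x e"
    and "(\<Sum>e\<in>set es. y e) = 0"
  shows "local_intersection es x y = (\<Sum>e\<in>set es. (2 * A e + x e) * y e)"
proof -
  let ?n = "length es"
  have step: "A (es ! Suc i) = A (es ! i) + x (es ! i)" if "Suc i < ?n" for i
    using assms(2)[of "es ! i"] that by (simp add: cycle_of_list_nth[OF assms(1)])
  have partial: "(\<Sum>k<i. x (es ! k)) = A (es ! i) - A (es ! 0)" if "i < ?n" for i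
    using that by (induction i) (auto simp: step)
  have y: "(\<Sum>i<?n. y (es ! i)) = 0"
    using assms(3) sum_list_index[OF assms(1), of y] by simp
  have "local_intersection es x y = (\<Sum>j<?n. (2 * (\<Sum>k<j. x (es ! k)) + x (es ! j)) * y (es ! j))"
    unfolding local_intersection_def using alternating_double_sum[of "\<lambda>i. x (es ! i)" "\<lambda>i. y (es ! i)" ?n] y
    by simp
  also have "\<dots> = (\<Sum>j<?n. (2 * A (es ! j) + x (es ! j)) * y (es ! j) - 2 * A (es ! 0) * y (es ! j))"
    by (intro sum.cong refl) (simp add: partial algebra_simps)
  also have "\<dots> = (\<Sum>j<?n. (2 * A (es ! j) + x (es ! j)) * y (es ! j))"
    by (simp add: sum_subtractf flip: sum_distrib_left) (simp add: y)
  also have "\<dots> = (\<Sum>e\<in>set es. (2 * A e + x e) * y e)"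
    by (simp add: sum_list_index[OF assms(1)])
  finally show ?thesis .
qed

lemma cyclic_invariant_constant:
  assumes "distinct es" and "\<And>e. e \<in> set es \<Longrightarrow> f (cycle_of_list es e) = f e"
    and "e \<in> set es" "e' \<in> set es"
  shows "f e = f e'"
proof -
  have "f (es ! i) = f (es ! 0)" if "i < length es" for i
    using that
  proof (induction i)
    case (Suc i)
    then show ?case
      using assms(2)[of "es ! i"] by (simp add: cycle_of_list_nth[OF assms(1)])
  qed simp
  then show ?thesis
    using assms(3,4) by (metis in_set_conv_nth)
qed

section \<open>Bipartite ribbon graphs\<close>

text \<open>The combinatorial data behind zig-zag loops and the intersection pairing. For a surface graph, \<open>rib\<close> is the
  counterclockwise order of the edges.\<close>

locale bipartite_ribbon_graph =
  fixes \<Gamma> :: "('s, 'e) bipartite_graph" and rib :: "'s \<Rightarrow> 'e list"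
  assumes finite_vertices: "finite (vertices \<Gamma>)"
    and finite_edges: "finite (edges \<Gamma>)"
    and black_white_disjoint: "black \<Gamma> \<inter> white \<Gamma> = {}"
    and black_end_black: "e \<in> edges \<Gamma> \<Longrightarrow> black_end \<Gamma> e \<in> black \<Gamma>"
    and white_end_white: "e \<in> edges \<Gamma> \<Longrightarrow> white_end \<Gamma> e \<in> white \<Gamma>"
    and distinct_rib: "v \<in> vertices \<Gamma> \<Longrightarrow> distinct (rib v)"
    and set_rib: "v \<in> vertices \<Gamma> \<Longrightarrow> set (rib v) = edges_at \<Gamma> v"
    and connected: "connected_graph \<Gamma>"
begin

abbreviation "V \<equiv> vertices \<Gamma>"
abbreviation "E \<equiv> edges \<Gamma>"
abbreviation "D \<equiv> oriented_edges \<Gamma>"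
abbreviation "b \<equiv> black_end \<Gamma>"
abbreviation "w \<equiv> white_end \<Gamma>"

text \<open>Successor in the ribbon graph obtained by reversing the cyclic orders at the white vertices.\<close>

definition twisted_next :: "'s \<Rightarrow> 'e \<Rightarrow> 'e" where
  "twisted_next v = cycle_of_list (reverse_at_white \<Gamma> rib v)"

text \<open>The group \<open>H\<^sub>1(\<Gamma>, \<int>)\<close>. At a given vertex all edges point outwards or all point inwards, so the boundary
  is an unsigned sum; the value off the edges is fixed to make equality of cycles equality of functions.\<close>

definition cycles :: "('e \<Rightarrow> int) set" where
  "cycles = {m. (\<forall>e. e \<notin> E \<longrightarrow> m e = 0) \<and> (\<forall>v\<in>V. (\<Sum>e\<in>edges_at \<Gamma> v. m e) = 0)}"

lemma ends_in_vertices: "e \<in> E \<Longrightarrow> b e \<in> V" "e \<in> E \<Longrightarrow> w e \<in> V"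
  using black_end_black white_end_white by (auto simp: vertices_def)

lemma black_end_not_white: "e \<in> E \<Longrightarrow> b e \<notin> white \<Gamma>"
  and white_end_not_black: "e \<in> E \<Longrightarrow> w e \<notin> black \<Gamma>"
  using black_white_disjoint black_end_black white_end_white by auto

lemma ends_distinct: "e \<in> E \<Longrightarrow> b e \<noteq> w e"
  using black_end_not_white white_end_white by metis

lemma edges_at_subset: "edges_at \<Gamma> v \<subseteq> E"
  by (auto simp: edges_at_def)

lemma finite_edges_at: "finite (edges_at \<Gamma> v)"
  using finite_subset[OF edges_at_subset finite_edges] .

lemma in_edges_at_ends: "e \<in> E \<Longrightarrow> e \<in> edges_at \<Gamma> (b e)" "e \<in> E \<Longrightarrow> e \<in> edges_at \<Gamma> (w e)"
  by (auto simp: edges_at_def)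

lemma edges_at_black: "v \<in> black \<Gamma> \<Longrightarrow> e \<in> edges_at \<Gamma> v \<Longrightarrow> b e = v"
  and edges_at_white: "v \<in> white \<Gamma> \<Longrightarrow> e \<in> edges_at \<Gamma> v \<Longrightarrow> w e = v"
  using black_end_not_white white_end_not_black by (auto simp: edges_at_def)

lemma twisted_rib:
  assumes "v \<in> V"
  shows "distinct (reverse_at_white \<Gamma> rib v)" "set (reverse_at_white \<Gamma> rib v) = edges_at \<Gamma> v"
  using assms distinct_rib set_rib by (auto simp: reverse_at_white_def)

lemma twisted_next_permutes: "v \<in> V \<Longrightarrow> twisted_next v permutes edges_at \<Gamma> v"
  using cycle_permutes[of "reverse_at_white \<Gamma> rib v"] twisted_rib(2) by (simp add: twisted_next_def)

lemma twisted_next_at: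
  "e \<in> E \<Longrightarrow> twisted_next (b e) e \<in> E" "e \<in> E \<Longrightarrow> b (twisted_next (b e) e) = b e"
  "e \<in> E \<Longrightarrow> twisted_next (w e) e \<in> E" "e \<in> E \<Longrightarrow> w (twisted_next (w e) e) = w e"
proof -
  assume e: "e \<in> E"
  have "twisted_next (b e) e \<in> edges_at \<Gamma> (b e)"
    using e twisted_next_permutes[OF ends_in_vertices(1)] in_edges_at_ends by (simp add: permutes_in_image)
  then show "twisted_next (b e) e \<in> E" "b (twisted_next (b e) e) = b e"
    using edges_at_subset edges_at_black[OF black_end_black] e by blast+
  have "twisted_next (w e) e \<in> edges_at \<Gamma> (w e)"
    using e twisted_next_permutes[OF ends_in_vertices(2)] in_edges_at_ends by (simp add: permutes_in_image)
  then show "twisted_next (w e) e \<in> E" "w (twisted_next (w e) e) = w e"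
    using edges_at_subset edges_at_white[OF white_end_white] e by blast+
qed

text \<open>Every edge has exactly two ends, and they are distinct because they have different colours.\<close>

lemma sum_over_vertices:
  fixes F :: "'s \<Rightarrow> 'e \<Rightarrow> 'a :: comm_monoid_add"
  shows "(\<Sum>v\<in>V. \<Sum>e\<in>edges_at \<Gamma> v. F v e) = (\<Sum>e\<in>E. F (b e) e + F (w e) e)"
proof -
  have "(\<Sum>v\<in>V. \<Sum>e\<in>edges_at \<Gamma> v. F v e) = (\<Sum>v\<in>V. \<Sum>e | e \<in> E \<and> (b e = v \<or> w e = v). F v e)"
    by (simp add: edges_at_def)
  also have "\<dots> = (\<Sum>e\<in>E. \<Sum>v | v \<in> V \<and> (b e = v \<or> w e = v). F v e)"
    by (rule sum.swap_restrict[OF finite_vertices finite_edges])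
  also have "\<dots> = (\<Sum>e\<in>E. \<Sum>v\<in>{b e, w e}. F v e)"
    using ends_in_vertices by (intro sum.cong refl) auto
  also have "\<dots> = (\<Sum>e\<in>E. F (b e) e + F (w e) e)"
    using ends_distinct by (intro sum.cong refl) simp
  finally show ?thesis .
qed

abbreviation "pairing \<equiv> intersection_number \<Gamma> (reverse_at_white \<Gamma> rib)"

text \<open>The factor 2 in the definition of the pairing is absorbed here: the two ends of an edge contribute
  \<open>2 * A v e + x e\<close> each.\<close>

lemma pairing_antiderivative:
  assumes "\<And>e. e \<in> E \<Longrightarrow> A (b e) (twisted_next (b e) e) = A (b e) e + x e"
    and "\<And>e. e \<in> E \<Longrightarrow> A (w e) (twisted_next (w e) e) = A (w e) e + x e"
    and "y \<in> cycles"
  shows "pairing x y = of_int (\<Sum>e\<in>E. (A (b e) e + A (w e) e + x e) * y e)"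
proof -
  have "local_intersection (reverse_at_white \<Gamma> rib v) x y = (\<Sum>e\<in>edges_at \<Gamma> v. (2 * A v e + x e) * y e)"
    if v: "v \<in> V" for v
  proof -
    have "A v (cycle_of_list (reverse_at_white \<Gamma> rib v) e) = A v e + x e" if "e \<in> edges_at \<Gamma> v" for e
      using assms(1,2)[of e] that by (auto simp: edges_at_def twisted_next_def)
    moreover have "(\<Sum>e\<in>edges_at \<Gamma> v. y e) = 0"
      using assms(3) v by (simp add: cycles_def)
    ultimately show ?thesis
      using local_intersection_antiderivative[of "reverse_at_white \<Gamma> rib v" "A v" x y] twisted_rib[OF v]
      by simp
  qed
  then have "pairing x y = of_int (\<Sum>v\<in>V. \<Sum>e\<in>edges_at \<Gamma> v. (2 * A v e + x e) * y e) / 2"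
    by (simp add: intersection_number_def)
  also have "(\<Sum>v\<in>V. \<Sum>e\<in>edges_at \<Gamma> v. (2 * A v e + x e) * y e) =
      (\<Sum>e\<in>E. 2 * ((A (b e) e + A (w e) e + x e) * y e))"
    unfolding sum_over_vertices by (intro sum.cong refl) (simp add: algebra_simps)
  also have "\<dots> = 2 * (\<Sum>e\<in>E. (A (b e) e + A (w e) e + x e) * y e)"
    by (simp add: sum_distrib_left)
  finally show ?thesis
    by simp
qed

lemma antiderivative_exists:
  assumes "x \<in> cycles"
  obtains A where "\<And>e. e \<in> E \<Longrightarrow> A (b e) (twisted_next (b e) e) = A (b e) e + x e"
    and "\<And>e. e \<in> E \<Longrightarrow> A (w e) (twisted_next (w e) e) = A (w e) e + x e"
proof -
  have "\<forall>v\<in>V. \<exists>A. \<forall>e\<in>edges_at \<Gamma> v. A (twisted_next v e) = A e + x e"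
  proof
    fix v assume "v \<in> V"
    then show "\<exists>A. \<forall>e\<in>edges_at \<Gamma> v. A (twisted_next v e) = A e + x e"
      using cyclic_antiderivative_exists[of "reverse_at_white \<Gamma> rib v" x] twisted_rib assms
      by (simp add: cycles_def twisted_next_def)
  qed
  from bchoice[OF this] obtain A
    where A: "A v (twisted_next v e) = A v e + x e" if "v \<in> V" "e \<in> edges_at \<Gamma> v" for v e
    by blast
  show ?thesis
  proof (rule that[of A])
    fix e assume "e \<in> E"
    then show "A (b e) (twisted_next (b e) e) = A (b e) e + x e"
      by (intro A ends_in_vertices in_edges_at_ends)
  next
    fix e assume "e \<in> E"
    then show "A (w e) (twisted_next (w e) e) = A (w e) e + x e"
      by (intro A ends_in_vertices in_edges_at_ends)
  qed
qed

text \<open>Coboundaries vanish on cycles; with all edges oriented from black to white, the usual difference of the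
  potentials at the ends becomes a sum when the potential is negated at the vertices of one colour.\<close>

lemma pairing_vertex_potential:
  assumes "y \<in> cycles"
  shows "(\<Sum>e\<in>E. (g (b e) + g (w e)) * y e) = (0::int)"
proof -
  have "(\<Sum>e\<in>E. (g (b e) + g (w e)) * y e) = (\<Sum>v\<in>V. g v * (\<Sum>e\<in>edges_at \<Gamma> v. y e))"
    using sum_over_vertices[of "\<lambda>v e. g v * y e"] by (simp add: algebra_simps sum_distrib_left)
  then show ?thesis
    using assms by (simp add: cycles_def)
qed

end

section \<open>Integral homology and closed walks\<close>

lemma loop_class_simps [simp]:
  "loop_class [] = (\<lambda>e. 0)"
  "loop_class ((f, s) # L) e = (if e = f then if s then 1 else - 1 else 0) + loop_class L e"
  by (auto simp: loop_class_def)

lemma loop_class_append: "loop_class (L @ L') e = loop_class L e + loop_class L' e"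
  by (simp add: loop_class_def)

lemma loop_class_reverse: "loop_class (rev (map reverse_edge L)) e = - loop_class L e"
proof (induction L)
  case (Cons d L)
  then show ?case
    by (cases d) (simp add: loop_class_append reverse_edge_def)
qed simp

context bipartite_ribbon_graph
begin

primrec walk :: "'s \<Rightarrow> 'e oriented_edge list \<Rightarrow> 's \<Rightarrow> bool" where
  "walk u [] v \<longleftrightarrow> u = v"
| "walk u (d # L) v \<longleftrightarrow> d \<in> D \<and> source \<Gamma> d = u \<and> walk (target \<Gamma> d) L v"

lemma walk_append: "walk u L v \<Longrightarrow> walk v L' x \<Longrightarrow> walk u (L @ L') x"
  by (induction L arbitrary: u) auto

lemma walk_reverse: "walk u L v \<Longrightarrow> walk v (rev (map reverse_edge L)) u"
proof (induction L arbitrary: u)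
  case (Cons d L)
  then have "walk (target \<Gamma> d) [reverse_edge d] u"
    by (auto simp: target_def reverse_edge_def oriented_edges_def)
  moreover have "walk v (rev (map reverse_edge L)) (target \<Gamma> d)"
    using Cons by simp
  ultimately show ?case
    using walk_append by fastforce
qed simp

lemma walk_set: "walk u L v \<Longrightarrow> set L \<subseteq> D"
  by (induction L arbitrary: u) auto

lemma walk_nth:
  "walk u L v \<Longrightarrow> i < length L \<Longrightarrow>
     source \<Gamma> (L ! i) = (if i = 0 then u else target \<Gamma> (L ! (i - 1))) \<and>
     (Suc i = length L \<longrightarrow> target \<Gamma> (L ! i) = v)"
proof (induction L arbitrary: u i)
  case (Cons d L)
  show ?case
  proof (cases i)
    case 0
    with Cons show ?thesis by (cases L) auto
  next
    case (Suc j)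
    with Cons.IH[of "target \<Gamma> d" j] Cons.prems show ?thesis
      by (auto simp: nth_Cons split: nat.splits)
  qed
qed simp

lemma closed_walk_oriented_loop:
  assumes "walk u L u"
  shows "oriented_loop \<Gamma> L"
  unfolding oriented_loop_def
proof (intro conjI allI impI)
  show "set L \<subseteq> D"
    using walk_set[OF assms] .
  fix i assume i: "i < length L"
  show "target \<Gamma> (L ! i) = source \<Gamma> (L ! (Suc i mod length L))"
  proof (cases "Suc i = length L")
    case True
    then show ?thesis
      using i walk_nth[OF assms i] walk_nth[OF assms, of 0] by (cases L) auto
  next
    case False
    then show ?thesis
      using walk_nth[OF assms, of "Suc i"] i by auto
  qed
qed

text \<open>The boundary of a walk; the sign is the one with which an edge, oriented from black to white, leaves \<open>v\<close>.\<close>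

lemma walk_boundary:
  assumes "walk u L u'" "v \<in> V"
  shows "(\<Sum>e\<in>edges_at \<Gamma> v. loop_class L e) =
    (if v \<in> black \<Gamma> then 1 else - 1) * ((if v = u then 1 else 0) - (if v = u' then 1 else 0))"
  using assms
proof (induction L arbitrary: u)
  case (Cons d L)
  obtain f s where d: "d = (f, s)"
    by fastforce
  have f: "f \<in> E"
    using Cons.prems d by (simp add: oriented_edges_def)
  have "(\<Sum>e\<in>edges_at \<Gamma> v. loop_class [d] e) =
      (if f \<in> edges_at \<Gamma> v then if s then 1 else - 1 else 0)"
    by (simp add: d finite_edges_at)
  also have "\<dots> = (if v \<in> black \<Gamma> then 1 else - 1) *
      ((if v = source \<Gamma> d then 1 else 0) - (if v = target \<Gamma> d then 1 else 0))"
    using f ends_distinct[OF f] black_end_black[OF f] white_end_not_black[OF f]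
    by (auto simp: d edges_at_def source_def target_def reverse_edge_def)
  moreover have "(\<Sum>e\<in>edges_at \<Gamma> v. loop_class (d # L) e) =
      (\<Sum>e\<in>edges_at \<Gamma> v. loop_class [d] e) + (\<Sum>e\<in>edges_at \<Gamma> v. loop_class L e)"
    by (simp add: d flip: sum.distrib)
  ultimately show ?case
    using Cons.IH[of "target \<Gamma> d"] Cons.prems by (simp add: algebra_simps)
qed simp

lemma loop_class_outside:
  assumes "set L \<subseteq> D" "e \<notin> E"
  shows "loop_class L e = 0"
proof -
  have "(e, s) \<notin> set L" for s
    using assms by (auto simp: oriented_edges_def)
  then show ?thesis
    by (simp add: loop_class_def)
qed

lemma closed_walk_cycle:
  assumes "walk u L u"
  shows "loop_class L \<in> cycles"
  using walk_boundary[OF assms] loop_class_outside[OF walk_set[OF assms]] by (simp add: cycles_def)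

lemma walk_exists:
  assumes "u \<in> V" "v \<in> V"
  shows "\<exists>L. walk u L v"
proof -
  let ?adj = "{(b e, w e) | e. e \<in> E}"
  have "(u, v) \<in> (?adj \<union> ?adj\<inverse>)\<^sup>*"
    using connected assms unfolding connected_graph_def Let_def by blast
  then show ?thesis
  proof induction
    case base
    then show ?case by (intro exI[of _ "[]"]) simp
  next
    case (step x y)
    then obtain e where "e \<in> E" "x = b e \<and> y = w e \<or> x = w e \<and> y = b e"
      by blast
    then have "walk x [(e, x = b e)] y"
      using ends_distinct by (auto simp: source_def target_def reverse_edge_def oriented_edges_def)
    with step.IH show ?case
      using walk_append by blast
  qed
qed

lemma based_walks: "\<exists>v\<^sub>0 P. \<forall>v\<in>V. walk v\<^sub>0 (P v) v"
proof (cases "V = {}")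
  case False
  then obtain v\<^sub>0 where "v\<^sub>0 \<in> V"
    by blast
  then have "\<forall>v\<in>V. \<exists>L. walk v\<^sub>0 L v"
    using walk_exists by blast
  from bchoice[OF this] show ?thesis
    by blast
qed simp

text \<open>Go to the black end of the edge from the base point, traverse the edge, and return from its white end.\<close>

lemma walk_around_edge:
  assumes "\<forall>v\<in>V. walk v\<^sub>0 (P v) v" and "e \<in> E"
  shows "\<exists>L. walk v\<^sub>0 L v\<^sub>0 \<and> (\<forall>f. loop_class L f =
    loop_class (P (b e)) f + (if f = e then 1 else 0) - loop_class (P (w e)) f)"
proof -
  let ?L = "P (b e) @ [(e, True)] @ rev (map reverse_edge (P (w e)))"
  have "walk (b e) [(e, True)] (w e)"
    using assms(2) by (simp add: source_def target_def reverse_edge_def oriented_edges_def)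
  then have "walk v\<^sub>0 ?L v\<^sub>0"
    using assms ends_in_vertices by (intro walk_append[of v\<^sub>0 _ "b e"] walk_append[of "b e" _ "w e"] walk_reverse) auto
  moreover have "loop_class ?L f =
      loop_class (P (b e)) f + (if f = e then 1 else 0) - loop_class (P (w e)) f" for f
    unfolding loop_class_append loop_class_reverse by simp
  ultimately show ?thesis
    by blast
qed

text \<open>The classes of closed walks at a base point form a group. It contains all cycles, because in the combination
  of the walks around the edges \<open>e\<close> with coefficients \<open>m e\<close> the paths from the base point cancel at every vertex.\<close>

lemma cycle_is_loop_class:
  assumes m: "m \<in> cycles"
  shows "\<exists>L. oriented_loop \<Gamma> L \<and> loop_class L = m"
proof -
  obtain v\<^sub>0 P where P: "\<forall>v\<in>V. walk v\<^sub>0 (P v) v"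
    using based_walks by blast
  define C where "C = {loop_class L | L. walk v\<^sub>0 L v\<^sub>0}"
  have zero: "(\<lambda>f. 0) \<in> C"
    unfolding C_def by (intro CollectI exI[of _ "[]"]) simp
  have add: "(\<lambda>f. x f + y f) \<in> C" if "x \<in> C" "y \<in> C" for x y
  proof -
    obtain L L' where "x = loop_class L" "walk v\<^sub>0 L v\<^sub>0" "y = loop_class L'" "walk v\<^sub>0 L' v\<^sub>0"
      using \<open>x \<in> C\<close> \<open>y \<in> C\<close> unfolding C_def by blast
    then show ?thesis
      unfolding C_def
      by (intro CollectI exI[of _ "L @ L'"]) (auto simp: fun_eq_iff loop_class_append intro: walk_append)
  qed
  have neg: "(\<lambda>f. - x f) \<in> C" if "x \<in> C" for x
  proof -
    obtain L where "x = loop_class L" "walk v\<^sub>0 L v\<^sub>0"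
      using \<open>x \<in> C\<close> unfolding C_def by blast
    then show ?thesis
      unfolding C_def
      by (intro CollectI exI[of _ "rev (map reverse_edge L)"]) (auto simp: fun_eq_iff loop_class_reverse intro: walk_reverse)
  qed
  have nat_multiple: "(\<lambda>f. int k * x f) \<in> C" if "x \<in> C" for x k
  proof (induction k)
    case (Suc k)
    from add[OF that this] show ?case
      by (simp add: algebra_simps)
  qed (simp add: zero)
  have multiple: "(\<lambda>f. k * x f) \<in> C" if "x \<in> C" for x k
  proof (cases "k \<ge> 0")
    case True
    then show ?thesis
      using nat_multiple[OF that, of "nat k"] by simp
  next
    case False
    then show ?thesis
      using neg[OF nat_multiple[OF that, of "nat (- k)"]] by simp
  qed
  define z where "z e f = loop_class (P (b e)) f + (if f = e then 1 else 0) - loop_class (P (w e)) f" for e f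
  have z: "z e \<in> C" if "e \<in> E" for e
  proof -
    obtain L where "walk v\<^sub>0 L v\<^sub>0" and "\<forall>f. loop_class L f = z e f"
      using walk_around_edge[OF P \<open>e \<in> E\<close>] unfolding z_def by blast
    then have "walk v\<^sub>0 L v\<^sub>0" and "loop_class L = z e"
      by auto
    then show ?thesis
      unfolding C_def by (intro CollectI exI[of _ L]) simp
  qed
  have partial: "(\<lambda>f. \<Sum>e\<in>F. m e * z e f) \<in> C" if "F \<subseteq> E" for F
    using finite_subset[OF that finite_edges] that
  proof (induction F)
    case (insert e F)
    then have "(\<lambda>f. m e * z e f + (\<Sum>e\<in>F. m e * z e f)) \<in> C"
      by (intro add multiple z) auto
    with insert show ?case by simp
  qed (simp add: zero)
  have "(\<Sum>e\<in>E. m e * z e f) = m f" for f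
  proof -
    \<comment> \<open>The contributions of the connecting paths form a vertex potential, which is orthogonal to \<open>m\<close>.\<close>
    define s :: "'s \<Rightarrow> int" where "s v = (if v \<in> black \<Gamma> then 1 else - 1)" for v
    have "(\<Sum>e\<in>E. m e * z e f) =
        (\<Sum>e\<in>E. (s (b e) * loop_class (P (b e)) f + s (w e) * loop_class (P (w e)) f) * m e) +
        (\<Sum>e\<in>E. if f = e then m e else 0)"
      unfolding sum.distrib[symmetric] z_def s_def
      using black_end_black white_end_not_black by (intro sum.cong refl) (auto simp: algebra_simps)
    also have "\<dots> = m f"
      using pairing_vertex_potential[OF m, of "\<lambda>v. s v * loop_class (P v) f"] m finite_edges
      by (auto simp: cycles_def)
    finally show ?thesis .
  qed
  then have "(\<lambda>f. \<Sum>e\<in>E. m e * z e f) = m"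
    by (rule ext)
  then have "m \<in> C"
    using partial[of E] by simp
  then show ?thesis
    using closed_walk_oriented_loop unfolding C_def by blast
qed

text \<open>The potential at \<open>v\<close> is the integral of \<open>c\<close> along a path from the base point; it does not depend on the path, since \<open>c\<close>
  vanishes on closed walks. It is negated at the black vertices to turn the difference over an edge into a sum.\<close>

lemma annihilator_of_cycles:
  fixes c :: "'e \<Rightarrow> int"
  assumes "\<And>y. y \<in> cycles \<Longrightarrow> (\<Sum>e\<in>E. c e * y e) = 0"
  shows "\<exists>g :: 's \<Rightarrow> int. \<forall>e\<in>E. c e = g (b e) + g (w e)"
proof -
  obtain v\<^sub>0 P where P: "\<forall>v\<in>V. walk v\<^sub>0 (P v) v"
    using based_walks by blast
  define h where "h v = (\<Sum>f\<in>E. c f * loop_class (P v) f)" for v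
  have "c e = h (w e) - h (b e)" if e: "e \<in> E" for e
  proof -
    obtain L where L: "walk v\<^sub>0 L v\<^sub>0"
      and L_class: "\<forall>f. loop_class L f =
        loop_class (P (b e)) f + (if f = e then 1 else 0) - loop_class (P (w e)) f"
      using walk_around_edge[OF P e] by blast
    have "0 = (\<Sum>f\<in>E. c f * loop_class L f)"
      using assms closed_walk_cycle[OF L] by simp
    also have "\<dots> = h (b e) + (\<Sum>f\<in>E. if f = e then c f else 0) - h (w e)"
      unfolding h_def sum.distrib[symmetric] sum_subtractf[symmetric]
      by (intro sum.cong refl) (auto simp: L_class algebra_simps)
    finally show ?thesis
      using e finite_edges by simp
  qed
  then show ?thesis
    using black_end_black white_end_not_black
    by (intro exI[of _ "\<lambda>v. if v \<in> black \<Gamma> then - h v else h v"]) simp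
qed

end

section \<open>Zig-zag loops and the radical of the intersection pairing\<close>

lemma count_list_distinct: "distinct L \<Longrightarrow> count_list L x = (if x \<in> set L then 1 else 0)"
  by (induction L) auto

context bipartite_ribbon_graph
begin

abbreviation "\<tau> \<equiv> zigzag_next \<Gamma> rib"
abbreviation "\<Z> \<equiv> zigzag_loops \<Gamma> rib"

lemma in_oriented_edges_iff: "(e, s) \<in> D \<longleftrightarrow> e \<in> E"
  by (simp add: oriented_edges_def)

text \<open>Left turns at white vertices and right turns at black ones follow the same rule once the orders at the white
  vertices are reversed, so zig-zag paths run along the boundary of the new ribbon surface.\<close>

lemma zigzag_next_edge:
  assumes "e \<in> E"
  shows "\<tau> (e, True) = (twisted_next (w e) e, False)" "\<tau> (e, False) = (twisted_next (b e) e, True)"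
  using assms black_end_not_white[OF assms] white_end_white[OF assms]
  by (simp_all add: zigzag_next_def turn_left_def turn_right_def twisted_next_def reverse_at_white_def
      target_def source_def reverse_edge_def)

lemma zigzag_next_closed: "d \<in> D \<Longrightarrow> \<tau> d \<in> D"
  by (cases d; cases "snd d") (auto simp: in_oriented_edges_iff zigzag_next_edge twisted_next_at)

lemma zigzag_next_inj: "inj_on \<tau> D"
proof (rule inj_onI)
  fix d d' assume "d \<in> D" "d' \<in> D" and eq: "\<tau> d = \<tau> d'"
  then obtain e s e' s' where d: "d = (e, s)" "d' = (e', s')" and e: "e \<in> E" and e': "e' \<in> E"
    by (metis in_oriented_edges_iff surj_pair)
  have inj: "inj (twisted_next v)" if "v \<in> V" for v
    using permutes_inj[OF twisted_next_permutes[OF that]] .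
  consider "s" "s'" | "\<not> s" "\<not> s'"
    using eq d zigzag_next_edge[OF e] zigzag_next_edge[OF e'] by (cases s; cases s') auto
  then show "d = d'"
  proof cases
    case 1
    then have "twisted_next (w e) e = twisted_next (w e') e'"
      using eq d zigzag_next_edge[OF e] zigzag_next_edge[OF e'] by simp
    moreover from this have "w e = w e'"
      using twisted_next_at(4)[OF e] twisted_next_at(4)[OF e'] by simp
    ultimately show ?thesis
      using d 1 injD[OF inj[OF ends_in_vertices(2)[OF e]]] by simp
  next
    case 2
    then have "twisted_next (b e) e = twisted_next (b e') e'"
      using eq d zigzag_next_edge[OF e] zigzag_next_edge[OF e'] by simp
    moreover from this have "b e = b e'"
      using twisted_next_at(2)[OF e] twisted_next_at(2)[OF e'] by simp
    ultimately show ?thesis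
      using d 2 injD[OF inj[OF ends_in_vertices(1)[OF e]]] by simp
  qed
qed

lemma finite_oriented_edges: "finite D"
  using finite_edges by (simp add: oriented_edges_def)

text \<open>The orbit of \<open>d\<close> under the permutation of the finite set of oriented edges given by the turning rule.\<close>

lemma zigzag_path_exists:
  assumes "d \<in> D"
  shows "\<exists>L. zigzag_path \<Gamma> rib L \<and> d \<in> set L"
proof -
  define p where "p x = (if x \<in> D then \<tau> x else x)" for x
  have "bij_betw \<tau> D D"
    using zigzag_next_inj zigzag_next_closed finite_oriented_edges
    by (simp add: bij_betw_def endo_inj_surj image_subset_iff)
  then have "bij_betw p D D"
    by (rule bij_betw_cong[THEN iffD1, rotated]) (simp add: p_def)
  then have "p permutes D"
    by (rule bij_imp_permutes) (simp add: p_def)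
  then have perm: "permutation p"
    using finite_oriented_edges permutation_permutes by blast
  let ?n = "least_power p d" and ?L = "support p d"
  have n: "(p ^^ ?n) d = d" "?n > 0"
    using least_power_of_permutation[OF perm] by auto
  have in_D: "(p ^^ i) d \<in> D" for i
    using assms by (induction i) (auto simp: p_def zigzag_next_closed)
  have "?L ! (Suc i mod length ?L) = \<tau> (?L ! i)" if i: "i < length ?L" for i
  proof (cases "Suc i = ?n")
    case True
    then show ?thesis
      using n i in_D[of i] by (metis (no_types, lifting) add_0 diff_zero funpow_0 funpow_simps_right(2) funpow_swap1
          length_map length_upt mod_self nth_map_upt o_apply p_def)
  next
    case False
    then show ?thesis
      using i in_D[of i] by (simp add: p_def)
  qed
  then have "zigzag_path \<Gamma> rib ?L"
    unfolding zigzag_path_def using cycle_of_permutation[OF perm] n(2) in_D by auto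
  moreover have "d \<in> set ?L"
    using n(2) by (auto intro!: image_eqI[of _ _ 0])
  ultimately show ?thesis
    by blast
qed

lemma zigzag_path_set_closed:
  assumes "zigzag_path \<Gamma> rib L" "x \<in> set L"
  shows "\<tau> x \<in> set L"
proof -
  obtain i where "i < length L" "x = L ! i"
    using assms(2) by (auto simp: in_set_conv_nth)
  moreover from this have "Suc i mod length L < length L"
    by (intro mod_less_divisor) linarith
  ultimately show ?thesis
    using assms(1) by (metis nth_mem zigzag_path_def)
qed

text \<open>A zig-zag path is a single orbit: starting from any of its edges, a closed set reaches all the others by going around
  the cycle.\<close>

lemma zigzag_path_minimal:
  assumes L: "zigzag_path \<Gamma> rib L" and d: "d \<in> set L" "d \<in> N"
    and N: "\<And>x. x \<in> N \<Longrightarrow> x \<in> set L \<Longrightarrow> \<tau> x \<in> N"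
  shows "set L \<subseteq> N"
proof
  let ?n = "length L"
  obtain i where i: "i < ?n" "d = L ! i"
    using d(1) by (auto simp: in_set_conv_nth)
  have reach: "L ! ((i + k) mod ?n) \<in> N" for k
  proof (induction k)
    case 0
    then show ?case using i d by simp
  next
    case (Suc k)
    have less: "(i + k) mod ?n < ?n"
      using i by (intro mod_less_divisor) linarith
    then have "L ! (Suc ((i + k) mod ?n) mod ?n) = \<tau> (L ! ((i + k) mod ?n))"
      using L by (simp add: zigzag_path_def)
    then show ?case
      using N[OF Suc nth_mem[OF less]] by (simp add: mod_Suc_eq)
  qed
  fix x assume "x \<in> set L"
  then obtain j where "j < ?n" "x = L ! j"
    by (auto simp: in_set_conv_nth)
  then show "x \<in> N"
    using reach[of "j + ?n - i"] i by simp
qed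

lemma zigzag_loop_subset: "Z \<in> \<Z> \<Longrightarrow> Z \<subseteq> D"
  by (auto simp: zigzag_loops_def zigzag_path_def)

lemma zigzag_loop_nonempty: "Z \<in> \<Z> \<Longrightarrow> Z \<noteq> {}"
  by (auto simp: zigzag_loops_def zigzag_path_def)

lemma finite_zigzag_loops: "finite \<Z>"
  using zigzag_loop_subset finite_oriented_edges by (intro finite_subset[of \<Z> "Pow D"]) auto

lemma zigzag_loop_closed: "Z \<in> \<Z> \<Longrightarrow> d \<in> Z \<Longrightarrow> \<tau> d \<in> Z"
  unfolding zigzag_loops_def using zigzag_path_set_closed by blast

lemma zigzag_loop_minimal:
  assumes "Z \<in> \<Z>" "d \<in> Z" "d \<in> N" "\<And>x. x \<in> N \<Longrightarrow> x \<in> Z \<Longrightarrow> \<tau> x \<in> N"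
  shows "Z \<subseteq> N"
  using assms zigzag_path_minimal unfolding zigzag_loops_def by blast

lemma zigzag_loops_disjoint:
  assumes "Z \<in> \<Z>" "Z' \<in> \<Z>" "d \<in> Z" "d \<in> Z'"
  shows "Z = Z'"
  using zigzag_loop_minimal[of Z d Z'] zigzag_loop_minimal[of Z' d Z] zigzag_loop_closed assms by blast

definition zigzag_through :: "'e oriented_edge \<Rightarrow> 'e oriented_edge set" where
  "zigzag_through d = (THE Z. Z \<in> \<Z> \<and> d \<in> Z)"

lemma zigzag_through_eq: "Z \<in> \<Z> \<Longrightarrow> d \<in> Z \<Longrightarrow> zigzag_through d = Z"
  unfolding zigzag_through_def by (rule the_equality) (auto dest: zigzag_loops_disjoint)

lemma zigzag_through:
  assumes "d \<in> D"
  shows "zigzag_through d \<in> \<Z>" "d \<in> zigzag_through d"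
proof -
  obtain Z where "Z \<in> \<Z>" "d \<in> Z"
    using zigzag_path_exists[OF assms] by (auto simp: zigzag_loops_def)
  then show "zigzag_through d \<in> \<Z>" "d \<in> zigzag_through d"
    using zigzag_through_eq by auto
qed

lemma zigzag_through_next: "d \<in> D \<Longrightarrow> zigzag_through (\<tau> d) = zigzag_through d"
  using zigzag_through zigzag_loop_closed zigzag_through_eq by metis

lemma invariant_constant_on_zigzag:
  assumes "\<And>d. d \<in> D \<Longrightarrow> \<nu> (\<tau> d) = \<nu> d" and "Z \<in> \<Z>" "d \<in> Z" "d' \<in> Z"
  shows "\<nu> d' = \<nu> d"
proof -
  have "Z \<subseteq> {x. \<nu> x = \<nu> d}"
    using assms(1) zigzag_loop_subset[OF assms(2)]
    by (intro zigzag_loop_minimal[OF assms(2,3)]) (auto simp: subset_iff)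
  then show ?thesis
    using assms(4) by blast
qed

definition zigzag_class :: "'e oriented_edge set \<Rightarrow> 'e \<Rightarrow> int" where
  "zigzag_class Z e = (if (e, True) \<in> Z then 1 else 0) - (if (e, False) \<in> Z then 1 else 0)"

text \<open>The integral combinations of the homology classes of the zig-zag loops.\<close>

definition zigzag_sum :: "('e oriented_edge set \<Rightarrow> int) \<Rightarrow> 'e \<Rightarrow> int" where
  "zigzag_sum n e = (\<Sum>Z\<in>\<Z>. n Z * zigzag_class Z e)"

lemma loop_class_zigzag_path: "zigzag_path \<Gamma> rib L \<Longrightarrow> loop_class L = zigzag_class (set L)"
  by (auto simp: fun_eq_iff loop_class_def zigzag_class_def zigzag_path_def count_list_distinct)

lemma zigzag_sum_single:
  assumes "Z \<in> \<Z>"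
  shows "zigzag_sum (\<lambda>Y. if Y = Z then 1 else 0) = zigzag_class Z"
proof
  fix e
  have "zigzag_sum (\<lambda>Y. if Y = Z then 1 else 0) e = (\<Sum>Y\<in>\<Z>. if Y = Z then zigzag_class Y e else 0)"
    unfolding zigzag_sum_def by (intro sum.cong refl) simp
  then show "zigzag_sum (\<lambda>Y. if Y = Z then 1 else 0) e = zigzag_class Z e"
    using assms finite_zigzag_loops by simp
qed

text \<open>Exactly one zig-zag loop traverses an edge in a given direction.\<close>

lemma zigzag_sum_edge:
  assumes "e \<in> E"
  shows "zigzag_sum n e = n (zigzag_through (e, True)) - n (zigzag_through (e, False))"
proof -
  have "(\<Sum>Z\<in>\<Z>. n Z * (if (e, s) \<in> Z then 1 else 0)) = n (zigzag_through (e, s))" for s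
  proof -
    have s: "(e, s) \<in> D"
      using assms by (simp add: in_oriented_edges_iff)
    have "(\<Sum>Z\<in>\<Z>. n Z * (if (e, s) \<in> Z then 1 else 0)) =
        (\<Sum>Z\<in>\<Z>. if Z = zigzag_through (e, s) then n Z else 0)"
    proof (intro sum.cong refl)
      fix Z assume "Z \<in> \<Z>"
      then have "(e, s) \<in> Z \<longleftrightarrow> Z = zigzag_through (e, s)"
        using zigzag_through_eq zigzag_through(2)[OF s] by blast
      then show "n Z * (if (e, s) \<in> Z then 1 else 0) = (if Z = zigzag_through (e, s) then n Z else 0)"
        by simp
    qed
    then show ?thesis
      using zigzag_through[OF s] finite_zigzag_loops by simp
  qed
  then show ?thesis
    by (simp add: zigzag_sum_def zigzag_class_def algebra_simps sum_subtractf)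
qed

lemma zigzag_sum_outside: "e \<notin> E \<Longrightarrow> zigzag_sum n e = 0"
  unfolding zigzag_sum_def zigzag_class_def
  using zigzag_loop_subset in_oriented_edges_iff by (intro sum.neutral) auto

text \<open>The function \<open>\<nu>\<close>, restricted to the oriented edges leaving or arriving at a vertex, is itself an antiderivative of \<open>x\<close> up to
  sign. For this choice the two antiderivatives on an edge cancel against \<open>x e\<close>.\<close>

lemma invariant_difference_in_radical:
  assumes \<nu>: "\<And>d. d \<in> D \<Longrightarrow> \<nu> (\<tau> d) = (\<nu> d :: int)"
    and x: "\<And>e. e \<in> E \<Longrightarrow> x e = \<nu> (e, True) - \<nu> (e, False)" "\<And>e. e \<notin> E \<Longrightarrow> x e = 0"
  shows "x \<in> cycles" and "y \<in> cycles \<Longrightarrow> pairing x y = 0"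
proof -
  \<comment> \<open>The values of \<open>\<nu>\<close> on the oriented edges leaving \<open>v\<close>, with a sign given by the colour.\<close>
  define A where "A v e = (if v \<in> black \<Gamma> then - \<nu> (e, True) else \<nu> (e, False))" for v e
  have A_b: "A (b e) (twisted_next (b e) e) = A (b e) e + x e"
    and A_w: "A (w e) (twisted_next (w e) e) = A (w e) e + x e" if e: "e \<in> E" for e
    using \<nu>[of "(e, True)"] \<nu>[of "(e, False)"] e black_end_black[OF e] white_end_not_black[OF e] x
    by (auto simp: A_def zigzag_next_edge in_oriented_edges_iff)
  show "x \<in> cycles"
    unfolding cycles_def
  proof (intro CollectI conjI allI impI ballI)
    fix v assume v: "v \<in> V"
    have "A v (twisted_next v e) = A v e + x e" if "e \<in> edges_at \<Gamma> v" for e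
      using that A_b A_w by (auto simp: edges_at_def)
    then show "(\<Sum>e\<in>edges_at \<Gamma> v. x e) = 0"
      using cyclic_antiderivative_sum[of "reverse_at_white \<Gamma> rib v" "A v" x] twisted_rib[OF v]
      by (simp add: twisted_next_def)
  qed (simp add: x)
  assume "y \<in> cycles"
  from pairing_antiderivative[of A x, OF A_b A_w this]
  have "pairing x y = of_int (\<Sum>e\<in>E. (A (b e) e + A (w e) e + x e) * y e)" .
  also have "\<dots> = 0"
    using black_end_black white_end_not_black x by (simp add: A_def)
  finally show "pairing x y = 0" .
qed

text \<open>Orthogonality to all cycles says that the sum of the antiderivatives and of \<open>x\<close> is a vertex potential. Correcting the
  antiderivatives by this potential makes the values obtained at both ends of an oriented edge agree.\<close>

lemma radical_is_invariant_difference: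
  assumes x: "x \<in> cycles" and "\<And>y. y \<in> cycles \<Longrightarrow> pairing x y = 0"
  shows "\<exists>\<nu>. (\<forall>d\<in>D. \<nu> (\<tau> d) = \<nu> d) \<and> (\<forall>e\<in>E. x e = \<nu> (e, True) - \<nu> (e, False))"
proof -
  obtain A where A_b: "\<And>e. e \<in> E \<Longrightarrow> A (b e) (twisted_next (b e) e) = A (b e) e + x e"
    and A_w: "\<And>e. e \<in> E \<Longrightarrow> A (w e) (twisted_next (w e) e) = A (w e) e + x e"
    using antiderivative_exists[OF x] by blast
  have "(\<Sum>e\<in>E. (A (b e) e + A (w e) e + x e) * y e) = 0" if "y \<in> cycles" for y
    using pairing_antiderivative[of A x, OF A_b A_w that] assms(2)[OF that] by (metis of_int_eq_0_iff)
  from annihilator_of_cycles[OF this] obtain g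
    where g: "\<forall>e\<in>E. A (b e) e + A (w e) e + x e = g (b e) + g (w e)"
    by blast
  \<comment> \<open>Antiderivative minus potential at the starting point of \<open>d\<close>, with opposite signs at the two colours.\<close>
  define \<nu> where "\<nu> d = (if snd d then g (b (fst d)) - A (b (fst d)) (fst d)
    else A (w (fst d)) (fst d) - g (w (fst d)))" for d
  have difference: "x e = \<nu> (e, True) - \<nu> (e, False)" if "e \<in> E" for e
    using g that by (simp add: \<nu>_def algebra_simps)
  have "\<nu> (\<tau> (e, s)) = \<nu> (e, s)" if e: "e \<in> E" for e s
    using difference[OF e] A_b[OF e] A_w[OF e]
    by (cases s) (simp_all add: zigzag_next_edge[OF e] \<nu>_def twisted_next_at[OF e])
  then have "\<forall>d\<in>D. \<nu> (\<tau> d) = \<nu> d"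
    by (auto simp: oriented_edges_def)
  with difference show ?thesis
    by blast
qed

lemma zigzag_sum_cycle: "zigzag_sum n \<in> cycles"
  and zigzag_sum_radical: "y \<in> cycles \<Longrightarrow> pairing (zigzag_sum n) y = 0"
proof -
  have \<nu>: "n (zigzag_through (\<tau> d)) = n (zigzag_through d)" if "d \<in> D" for d
    using that by (simp add: zigzag_through_next)
  from invariant_difference_in_radical[OF this zigzag_sum_edge zigzag_sum_outside]
  show "zigzag_sum n \<in> cycles" "y \<in> cycles \<Longrightarrow> pairing (zigzag_sum n) y = 0"
    by auto
qed

lemma radical_is_zigzag_sum:
  assumes "x \<in> cycles" and "\<And>y. y \<in> cycles \<Longrightarrow> pairing x y = 0"
  shows "\<exists>n. x = zigzag_sum n"
proof -
  obtain \<nu> where \<nu>: "\<forall>d\<in>D. \<nu> (\<tau> d) = \<nu> d" and x: "\<forall>e\<in>E. x e = \<nu> (e, True) - \<nu> (e, False)"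
    using radical_is_invariant_difference[OF assms] by blast
  define n where "n Z = \<nu> (SOME d. d \<in> Z)" for Z
  have n: "n (zigzag_through d) = \<nu> d" if d: "d \<in> D" for d
    unfolding n_def
    by (rule invariant_constant_on_zigzag[OF _ zigzag_through[OF d] someI[of "\<lambda>x. x \<in> zigzag_through d", OF zigzag_through(2)[OF d]]])
      (use \<nu> in blast)
  have "x e = zigzag_sum n e" for e
  proof (cases "e \<in> E")
    case True
    then show ?thesis
      using x n by (simp add: zigzag_sum_edge in_oriented_edges_iff)
  next
    case False
    then show ?thesis
      using assms(1) by (simp add: zigzag_sum_outside cycles_def)
  qed
  then show ?thesis
    by blast
qed

text \<open>The two sides of every edge cancel.\<close>

lemma zigzag_sum_const: "zigzag_sum (\<lambda>Z. k) = (\<lambda>e. 0)"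
proof
  fix e show "zigzag_sum (\<lambda>Z. k) e = 0"
    by (cases "e \<in> E") (simp_all add: zigzag_sum_edge zigzag_sum_outside)
qed

lemma zigzag_sum_add: "zigzag_sum (\<lambda>Z. n Z + n' Z) e = zigzag_sum n e + zigzag_sum n' e"
  and zigzag_sum_diff: "zigzag_sum (\<lambda>Z. n Z - n' Z) e = zigzag_sum n e - zigzag_sum n' e"
  by (simp_all add: zigzag_sum_def algebra_simps sum.distrib sum_subtractf)

text \<open>If the combination vanishes, the loops through the two orientations of each edge have the same coefficient, which is
  thus a function of the edge. It is also constant along zig-zag paths, hence constant around each vertex, and
  connectedness of the graph does the rest.\<close>

lemma zigzag_sum_eq_zero:
  assumes "\<And>e. zigzag_sum n e = 0" "Z \<in> \<Z>" "Z' \<in> \<Z>"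
  shows "n Z = n Z'"
proof -
  define \<kappa> where "\<kappa> e = n (zigzag_through (e, True))" for e
  have \<kappa>: "n (zigzag_through (e, s)) = \<kappa> e" if "e \<in> E" for e s
    using zigzag_sum_edge[OF that, of n] assms(1)[of e] by (cases s) (simp_all add: \<kappa>_def)
  have next_const: "\<kappa> (twisted_next v e) = \<kappa> e" if "e \<in> edges_at \<Gamma> v" for v e
  proof -
    have e: "e \<in> E"
      using that edges_at_subset by blast
    then show ?thesis
      using that zigzag_through_next[of "(e, True)"] zigzag_through_next[of "(e, False)"]
        \<kappa>[OF e] \<kappa>[OF twisted_next_at(1)[OF e]] \<kappa>[OF twisted_next_at(3)[OF e]]
      by (auto simp: edges_at_def zigzag_next_edge in_oriented_edges_iff) metis+
  qed
  have vertex_const: "\<kappa> e = \<kappa> f" if "v \<in> V" "e \<in> edges_at \<Gamma> v" "f \<in> edges_at \<Gamma> v" for v e f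
    using cyclic_invariant_constant[of "reverse_at_white \<Gamma> rib v" \<kappa> e f] twisted_rib[OF that(1)] next_const that
    by (simp add: twisted_next_def)
  have walk_const: "\<kappa> e = \<kappa> f" if "walk u L v" "u \<in> V" "e \<in> edges_at \<Gamma> u" "f \<in> edges_at \<Gamma> v" for u L v e f
    using that
  proof (induction L arbitrary: u e)
    case Nil
    then have "f \<in> edges_at \<Gamma> u"
      by simp
    then show ?case
      by (rule vertex_const[OF Nil(2,3)])
  next
    case (Cons d L)
    obtain h s where d: "d = (h, s)"
      by fastforce
    have h: "h \<in> E" "h \<in> edges_at \<Gamma> u" "h \<in> edges_at \<Gamma> (target \<Gamma> d)" "target \<Gamma> d \<in> V"
      using Cons.prems(1) d ends_in_vertices
      by (auto simp: in_oriented_edges_iff edges_at_def source_def target_def reverse_edge_def)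
    have "\<kappa> h = \<kappa> f"
      using Cons.prems(1) by (intro Cons.IH[OF _ h(4,3) Cons.prems(4)]) simp
    with vertex_const[OF Cons.prems(2,3) h(2)] show ?case
      by simp
  qed
  obtain e s where e: "(e, s) \<in> Z"
    using zigzag_loop_nonempty[OF assms(2)] by fastforce
  obtain f t where f: "(f, t) \<in> Z'"
    using zigzag_loop_nonempty[OF assms(3)] by fastforce
  have E: "e \<in> E" "f \<in> E"
    using e f assms zigzag_loop_subset in_oriented_edges_iff by blast+
  obtain L where "walk (b e) L (b f)"
    using walk_exists E ends_in_vertices by blast
  then have "\<kappa> e = \<kappa> f"
    by (rule walk_const) (use E ends_in_vertices in_edges_at_ends in auto)
  then show ?thesis
    using \<kappa>[OF E(1), of s] \<kappa>[OF E(2), of t] zigzag_through_eq[OF assms(2) e] zigzag_through_eq[OF assms(3) f]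
    by simp
qed

end

section \<open>Linear independence of characters\<close>

text \<open>Dedekind's argument: translating a relation by \<open>y\<close> and subtracting its multiple with factor \<open>h j y\<close> removes the
  character \<open>h j\<close> from it.\<close>

lemma characters_independent:
  fixes h :: "'i \<Rightarrow> 'g \<Rightarrow> 'k :: field"
  assumes "finite I"
    and "\<And>i j. i \<in> I \<Longrightarrow> j \<in> I \<Longrightarrow> i \<noteq> j \<Longrightarrow> \<exists>x\<in>G. h i x \<noteq> h j x"
    and "\<And>i. i \<in> I \<Longrightarrow> \<exists>x\<in>G. h i x \<noteq> 0"
    and "\<And>x y. x \<in> G \<Longrightarrow> y \<in> G \<Longrightarrow> mul x y \<in> G"
    and "\<And>i x y. i \<in> I \<Longrightarrow> x \<in> G \<Longrightarrow> y \<in> G \<Longrightarrow> h i (mul x y) = h i x * h i y"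
    and "\<And>x. x \<in> G \<Longrightarrow> (\<Sum>i\<in>I. a i * h i x) = 0"
  shows "\<forall>i\<in>I. a i = 0"
  using assms
proof (induction I arbitrary: a rule: finite_induct)
  case (insert j I)
  have rest: "a i = 0" if i: "i \<in> I" for i
  proof -
    obtain y where y: "y \<in> G" "h i y \<noteq> h j y"
      using insert.prems(1)[of i j] insert.hyps i by auto
    have "(\<Sum>i\<in>I. (a i * (h i y - h j y)) * h i x) = 0" if x: "x \<in> G" for x
    proof -
      have "(\<Sum>i\<in>I. (a i * (h i y - h j y)) * h i x) =
          (\<Sum>i\<in>insert j I. (a i * (h i y - h j y)) * h i x)"
        using insert.hyps by simp
      also have "\<dots> = (\<Sum>i\<in>insert j I. a i * h i (mul x y)) - h j y * (\<Sum>i\<in>insert j I. a i * h i x)"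
        unfolding sum_distrib_left sum_subtractf[symmetric]
        using insert.prems(4) x y(1) by (intro sum.cong refl) (simp add: algebra_simps)
      also have "\<dots> = 0"
        using insert.prems(5)[OF x] insert.prems(5)[OF insert.prems(3)[OF x y(1)]] by simp
      finally show ?thesis .
    qed
    then have "\<forall>i\<in>I. a i * (h i y - h j y) = 0"
      using insert.prems by (intro insert.IH) auto
    then have "a i * (h i y - h j y) = 0"
      using i by blast
    then show ?thesis
      using y by simp
  qed
  moreover obtain x where "x \<in> G" "h j x \<noteq> 0"
    using insert.prems(2)[of j] by auto
  moreover from this have "a j * h j x = 0"
    using insert.prems(5)[of x] insert.hyps rest by simp
  ultimately show ?case
    by simp
qed simp

lemma power_int_sum:
  fixes x :: "'k :: field"
  assumes "x \<noteq> 0"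
  shows "x powi (\<Sum>i\<in>I. f i) = (\<Prod>i\<in>I. x powi f i)"
  using assms by (induction I rule: infinite_finite_induct) (auto simp: power_int_add)

lemma two_powi_inject: "(2 :: complex) powi k = 2 powi l \<longleftrightarrow> k = l"
proof
  assume "(2 :: complex) powi k = 2 powi l"
  then have eq: "(2 :: real) powi k = 2 powi l"
    by (metis norm_numeral norm_power_int)
  show "k = l"
    using power_int_strict_increasing[of k l "2 :: real"] power_int_strict_increasing[of l k "2 :: real"] eq
    by (cases k l rule: linorder_cases) auto
qed simp

section \<open>Characters of the moduli space of line bundles with connection\<close>

text \<open>The characters of the torus of connections, indexed by integral 1-chains.\<close>

definition edge_character :: "('s, 'e) bipartite_graph \<Rightarrow> ('e \<Rightarrow> int) \<Rightarrow> ('e oriented_edge \<Rightarrow> complex) \<Rightarrow> complex" where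
  "edge_character \<Gamma> m \<Phi> = (\<Prod>e\<in>edges \<Gamma>. \<Phi> (e, True) powi m e)"

text \<open>The function on the moduli space induced by a character that is gauge invariant, that is, whose index is a cycle. The
  choice of a representative connection is then immaterial.\<close>

definition class_character :: "('s, 'e) bipartite_graph \<Rightarrow> ('e \<Rightarrow> int) \<Rightarrow> 'e line_bundle_class \<Rightarrow> complex" where
  "class_character \<Gamma> m = (\<lambda>l\<in>line_bundles \<Gamma>. edge_character \<Gamma> m (SOME \<Phi>. \<Phi> \<in> l))"

text \<open>The connection with prescribed transports along the edges, oriented from black to white.\<close>

definition connection_of :: "('s, 'e) bipartite_graph \<Rightarrow> ('e \<Rightarrow> complex) \<Rightarrow> 'e oriented_edge \<Rightarrow> complex" where
  "connection_of \<Gamma> \<phi> = (\<lambda>d\<in>oriented_edges \<Gamma>. if snd d then \<phi> (fst d) else inverse (\<phi> (fst d)))"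

context bipartite_ribbon_graph
begin

abbreviation "\<T> \<equiv> edge_character \<Gamma>"
abbreviation "\<W> \<equiv> class_character \<Gamma>"
abbreviation "bundle_of \<Phi> \<equiv> gauge_equivalence \<Gamma> `` {\<Phi>}"

lemma connection_nonzero: "\<Phi> \<in> connections \<Gamma> \<Longrightarrow> e \<in> E \<Longrightarrow> \<Phi> (e, s) \<noteq> 0"
  by (auto simp: connections_def PiE_iff oriented_edges_def)

lemma connection_reverse:
  assumes "\<Phi> \<in> connections \<Gamma>" "e \<in> E"
  shows "\<Phi> (e, False) = inverse (\<Phi> (e, True))"
proof -
  have "\<Phi> (reverse_edge (e, True)) = inverse (\<Phi> (e, True))"
    using assms by (simp add: connections_def oriented_edges_def)
  then show ?thesis
    by (simp add: reverse_edge_def)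
qed

lemma connection_of_connection:
  assumes "\<And>e. e \<in> E \<Longrightarrow> \<phi> e \<noteq> 0"
  shows "connection_of \<Gamma> \<phi> \<in> connections \<Gamma>"
  using assms by (auto simp: connections_def connection_of_def oriented_edges_def reverse_edge_def split: if_splits)

lemma edge_character_connection_of: "\<T> m (connection_of \<Gamma> \<phi>) = (\<Prod>e\<in>E. \<phi> e powi m e)"
  by (simp add: edge_character_def connection_of_def oriented_edges_def)

lemma edge_character_nonzero: "\<Phi> \<in> connections \<Gamma> \<Longrightarrow> \<T> m \<Phi> \<noteq> 0"
  using finite_edges connection_nonzero by (auto simp: edge_character_def power_int_eq_0_iff)

lemma edge_character_add: "\<Phi> \<in> connections \<Gamma> \<Longrightarrow> \<T> (\<lambda>e. m e + m' e) \<Phi> = \<T> m \<Phi> * \<T> m' \<Phi>"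
  using connection_nonzero by (simp add: edge_character_def power_int_add prod.distrib)

lemma edge_character_zero: "\<T> (\<lambda>e. 0) \<Phi> = 1"
  by (simp add: edge_character_def)

lemma edge_characters_independent:
  assumes "finite M" and "\<And>m e. m \<in> M \<Longrightarrow> e \<notin> E \<Longrightarrow> m e = 0"
    and "\<And>\<Phi>. \<Phi> \<in> connections \<Gamma> \<Longrightarrow> (\<Sum>m\<in>M. a m * \<T> m \<Phi>) = 0"
  shows "\<forall>m\<in>M. a m = 0"
proof -
  let ?mul = "\<lambda>\<Phi> \<Psi>. connection_of \<Gamma> (\<lambda>e. \<Phi> (e, True) * \<Psi> (e, True))"
  have closed: "?mul \<Phi> \<Psi> \<in> connections \<Gamma>" if "\<Phi> \<in> connections \<Gamma>" "\<Psi> \<in> connections \<Gamma>" for \<Phi> \<Psi>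
    using that connection_nonzero by (intro connection_of_connection) auto
  have multiplicative: "\<T> m (?mul \<Phi> \<Psi>) = \<T> m \<Phi> * \<T> m \<Psi>" for m \<Phi> \<Psi>
    unfolding edge_character_connection_of by (simp add: edge_character_def power_int_mult_distrib prod.distrib)
  have nonzero: "\<exists>\<Phi>\<in>connections \<Gamma>. \<T> m \<Phi> \<noteq> 0" for m
  proof -
    have "connection_of \<Gamma> (\<lambda>e. 1) \<in> connections \<Gamma>"
      by (rule connection_of_connection, simp)
    then show ?thesis
      by (intro bexI[of _ "connection_of \<Gamma> (\<lambda>e. 1)"] edge_character_nonzero)
  qed
  have separated: "\<exists>\<Phi>\<in>connections \<Gamma>. \<T> m \<Phi> \<noteq> \<T> m' \<Phi>" if "m \<in> M" "m' \<in> M" "m \<noteq> m'" for m m'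
  proof -
    obtain e where e: "m e \<noteq> m' e"
      using \<open>m \<noteq> m'\<close> by blast
    then have "e \<in> E"
      using assms(2)[OF that(1), of e] assms(2)[OF that(2), of e] by (cases "e \<in> E") auto
    \<comment> \<open>A power of 2 determines its exponent, so this connection separates the exponents at \<open>e\<close>.\<close>
    let ?\<Phi> = "connection_of \<Gamma> (\<lambda>f. if f = e then 2 else 1)"
    have "\<T> k ?\<Phi> = 2 powi k e" for k
    proof -
      have "\<T> k ?\<Phi> = (\<Prod>f\<in>E. if f = e then 2 powi k f else 1)"
        unfolding edge_character_connection_of by (intro prod.cong refl) simp
      then show ?thesis
        using finite_edges \<open>e \<in> E\<close> by simp
    qed
    then have "\<T> m ?\<Phi> \<noteq> \<T> m' ?\<Phi>"
      using e by (simp add: two_powi_inject)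
    moreover have "?\<Phi> \<in> connections \<Gamma>"
      by (rule connection_of_connection) simp
    ultimately show ?thesis
      by blast
  qed
  show ?thesis
    by (rule characters_independent[of M "connections \<Gamma>" \<T> ?mul a,
          OF assms(1) separated nonzero closed multiplicative assms(3)])
qed

lemma prod_over_vertices:
  fixes F :: "'s \<Rightarrow> 'e \<Rightarrow> 'a :: comm_monoid_mult"
  shows "(\<Prod>v\<in>V. \<Prod>e\<in>edges_at \<Gamma> v. F v e) = (\<Prod>e\<in>E. F (b e) e * F (w e) e)"
proof -
  have "(\<Prod>v\<in>V. \<Prod>e\<in>edges_at \<Gamma> v. F v e) = (\<Prod>v\<in>V. \<Prod>e | e \<in> E \<and> (b e = v \<or> w e = v). F v e)"
    by (simp add: edges_at_def)
  also have "\<dots> = (\<Prod>e\<in>E. \<Prod>v | v \<in> V \<and> (b e = v \<or> w e = v). F v e)"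
    by (rule prod.swap_restrict[OF finite_vertices finite_edges])
  also have "\<dots> = (\<Prod>e\<in>E. \<Prod>v\<in>{b e, w e}. F v e)"
    using ends_in_vertices by (intro prod.cong refl) auto
  also have "\<dots> = (\<Prod>e\<in>E. F (b e) e * F (w e) e)"
    using ends_distinct by (intro prod.cong refl) simp
  finally show ?thesis .
qed

text \<open>A gauge transformation acts on a character through the boundary of its index; the exponent is negated at black
  vertices, where the edges start.\<close>

lemma edge_character_gauge:
  assumes "\<And>v. v \<in> V \<Longrightarrow> g v \<noteq> 0"
    and "\<And>e. e \<in> E \<Longrightarrow> \<Psi> (e, True) = g (w e) * \<Phi> (e, True) / g (b e)"
  shows "\<T> m \<Psi> =
    (\<Prod>v\<in>V. g v powi ((if v \<in> black \<Gamma> then - 1 else 1) * (\<Sum>e\<in>edges_at \<Gamma> v. m e))) * \<T> m \<Phi>"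
proof -
  define s :: "'s \<Rightarrow> int" where "s v = (if v \<in> black \<Gamma> then - 1 else 1)" for v
  have "(\<Prod>v\<in>V. g v powi (s v * (\<Sum>e\<in>edges_at \<Gamma> v. m e))) = (\<Prod>v\<in>V. \<Prod>e\<in>edges_at \<Gamma> v. g v powi (s v * m e))"
    using assms(1) by (intro prod.cong refl) (simp add: sum_distrib_left power_int_sum)
  also have "\<dots> = (\<Prod>e\<in>E. g (b e) powi (s (b e) * m e) * g (w e) powi (s (w e) * m e))"
    by (rule prod_over_vertices)
  finally have "(\<Prod>v\<in>V. g v powi (s v * (\<Sum>e\<in>edges_at \<Gamma> v. m e))) * \<T> m \<Phi> =
      (\<Prod>e\<in>E. g (b e) powi (s (b e) * m e) * g (w e) powi (s (w e) * m e) * \<Phi> (e, True) powi m e)"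
    by (simp add: edge_character_def prod.distrib)
  also have "\<dots> = \<T> m \<Psi>"
    unfolding edge_character_def
  proof (intro prod.cong refl)
    fix e assume e: "e \<in> E"
    then have "s (b e) = - 1" "s (w e) = 1"
      using black_end_black white_end_not_black by (auto simp: s_def)
    then show "g (b e) powi (s (b e) * m e) * g (w e) powi (s (w e) * m e) * \<Phi> (e, True) powi m e =
        \<Psi> (e, True) powi m e"
      using e by (simp add: assms(2) power_int_mult_distrib power_int_divide_distrib power_int_minus
          power_int_inverse divide_inverse)
  qed
  finally show ?thesis
    by (simp add: s_def)
qed

lemma gauge_equivalence_edge:
  assumes "(\<Phi>, \<Psi>) \<in> gauge_equivalence \<Gamma>"
  obtains g where "\<forall>v\<in>V. g v \<noteq> 0" "\<forall>e\<in>E. \<Psi> (e, True) = g (w e) * \<Phi> (e, True) / g (b e)"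
proof -
  obtain g where g: "\<forall>v\<in>V. g v \<noteq> 0"
    "\<forall>d\<in>D. \<Psi> d = g (target \<Gamma> d) * \<Phi> d / g (source \<Gamma> d)"
    using assms unfolding gauge_equivalence_def by blast
  then have "\<forall>e\<in>E. \<Psi> (e, True) = g (w e) * \<Phi> (e, True) / g (b e)"
    by (auto simp: oriented_edges_def source_def target_def reverse_edge_def)
  with g(1) show ?thesis
    by (rule that)
qed

lemma gauge_transform:
  assumes \<Phi>: "\<Phi> \<in> connections \<Gamma>" and g: "\<And>v. v \<in> V \<Longrightarrow> g v \<noteq> 0"
  shows "(\<Phi>, connection_of \<Gamma> (\<lambda>e. g (w e) * \<Phi> (e, True) / g (b e))) \<in> gauge_equivalence \<Gamma>"
proof -
  let ?\<Psi> = "connection_of \<Gamma> (\<lambda>e. g (w e) * \<Phi> (e, True) / g (b e))"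
  have "?\<Psi> \<in> connections \<Gamma>"
    using connection_nonzero[OF \<Phi>] g ends_in_vertices by (intro connection_of_connection) auto
  moreover have "?\<Psi> d = g (target \<Gamma> d) * \<Phi> d / g (source \<Gamma> d)" if "d \<in> D" for d
    using that connection_reverse[OF \<Phi>]
    by (cases d; cases "snd d")
      (auto simp: connection_of_def oriented_edges_def source_def target_def reverse_edge_def divide_inverse)
  ultimately show ?thesis
    using \<Phi> g unfolding gauge_equivalence_def by blast
qed

lemma edge_character_invariant:
  assumes "m \<in> cycles" "(\<Phi>, \<Psi>) \<in> gauge_equivalence \<Gamma>"
  shows "\<T> m \<Psi> = \<T> m \<Phi>"
proof -
  obtain g where "\<forall>v\<in>V. g v \<noteq> 0" "\<forall>e\<in>E. \<Psi> (e, True) = g (w e) * \<Phi> (e, True) / g (b e)"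
    using gauge_equivalence_edge[OF assms(2)] .
  then show ?thesis
    using edge_character_gauge[of g \<Psi> \<Phi> m] assms(1) by (simp add: cycles_def)
qed

lemma gauge_equivalence_refl:
  assumes "\<Phi> \<in> connections \<Gamma>"
  shows "(\<Phi>, \<Phi>) \<in> gauge_equivalence \<Gamma>"
proof -
  have "\<exists>g. (\<forall>v\<in>V. g v \<noteq> 0) \<and> (\<forall>d\<in>D. \<Phi> d = g (target \<Gamma> d) * \<Phi> d / g (source \<Gamma> d))"
    by (rule exI[of _ "\<lambda>v. 1"]) simp
  then show ?thesis
    using assms by (simp add: gauge_equivalence_def)
qed

lemma bundle_of_line_bundle: "\<Phi> \<in> connections \<Gamma> \<Longrightarrow> bundle_of \<Phi> \<in> line_bundles \<Gamma>"
  unfolding line_bundles_def by (rule quotientI)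

lemma line_bundle_cases:
  assumes "l \<in> line_bundles \<Gamma>"
  obtains \<Phi> where "\<Phi> \<in> connections \<Gamma>" "l = bundle_of \<Phi>"
  using assms unfolding line_bundles_def by (rule quotientE)

lemma class_character_bundle_of:
  assumes "m \<in> cycles" "\<Phi> \<in> connections \<Gamma>"
  shows "\<W> m (bundle_of \<Phi>) = \<T> m \<Phi>"
proof -
  have "bundle_of \<Phi> \<noteq> {}"
    using gauge_equivalence_refl[OF assms(2)] by blast
  then have "(\<Phi>, SOME \<Psi>. \<Psi> \<in> bundle_of \<Phi>) \<in> gauge_equivalence \<Gamma>"
    using some_in_eq[of "bundle_of \<Phi>"] by simp
  from edge_character_invariant[OF assms(1) this] show ?thesis
    using bundle_of_line_bundle[OF assms(2)] by (simp add: class_character_def)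
qed

lemma zero_cycle: "(\<lambda>e. 0) \<in> cycles"
  by (simp add: cycles_def)

lemma add_cycles: "m \<in> cycles \<Longrightarrow> m' \<in> cycles \<Longrightarrow> (\<lambda>e. m e + m' e) \<in> cycles"
  by (simp add: cycles_def sum.distrib)

lemma class_character_add:
  "m \<in> cycles \<Longrightarrow> m' \<in> cycles \<Longrightarrow> l \<in> line_bundles \<Gamma> \<Longrightarrow> \<W> (\<lambda>e. m e + m' e) l = \<W> m l * \<W> m' l"
  by (erule line_bundle_cases) (simp add: class_character_bundle_of edge_character_add add_cycles)

lemma class_character_zero: "l \<in> line_bundles \<Gamma> \<Longrightarrow> \<W> (\<lambda>e. 0) l = 1"
  by (erule line_bundle_cases) (simp add: class_character_bundle_of zero_cycle edge_character_zero)

lemma class_character_extensional: "\<W> m \<in> extensional (line_bundles \<Gamma>)"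
  by (simp add: class_character_def)

text \<open>Stated for families with possibly coinciding indices, as they arise when polynomials in the zig-zag monodromies are
  expanded.\<close>

lemma class_characters_independent:
  assumes "finite I" and "\<And>i. i \<in> I \<Longrightarrow> \<mu> i \<in> cycles"
    and "\<And>l. l \<in> line_bundles \<Gamma> \<Longrightarrow> (\<Sum>i\<in>I. a i * \<W> (\<mu> i) l) = 0"
  shows "(\<Sum>i | i \<in> I \<and> \<mu> i = m. a i) = 0"
proof -
  have "(\<Sum>m\<in>\<mu> ` I. (\<Sum>i | i \<in> I \<and> \<mu> i = m. a i) * \<T> m \<Phi>) = 0" if \<Phi>: "\<Phi> \<in> connections \<Gamma>" for \<Phi>
  proof -
    have "(\<Sum>m\<in>\<mu> ` I. (\<Sum>i | i \<in> I \<and> \<mu> i = m. a i) * \<T> m \<Phi>) =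
        (\<Sum>m\<in>\<mu> ` I. \<Sum>i | i \<in> I \<and> \<mu> i = m. a i * \<T> (\<mu> i) \<Phi>)"
      by (intro sum.cong refl) (simp add: sum_distrib_right)
    also have "\<dots> = (\<Sum>i\<in>I. a i * \<T> (\<mu> i) \<Phi>)"
      using sum.image_gen[OF assms(1), of "\<lambda>i. a i * \<T> (\<mu> i) \<Phi>" \<mu>] by simp
    also have "\<dots> = (\<Sum>i\<in>I. a i * \<W> (\<mu> i) (bundle_of \<Phi>))"
      using assms(2) \<Phi> by (intro sum.cong refl) (simp add: class_character_bundle_of)
    also have "\<dots> = 0"
      using assms(3) bundle_of_line_bundle[OF \<Phi>] by simp
    finally show ?thesis .
  qed
  then have zero: "\<forall>m\<in>\<mu> ` I. (\<Sum>i | i \<in> I \<and> \<mu> i = m. a i) = 0"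
    using assms(1,2) by (intro edge_characters_independent) (auto simp: cycles_def)
  show ?thesis
  proof (cases "m \<in> \<mu> ` I")
    case True
    then show ?thesis using zero by blast
  next
    case False
    then have "{i. i \<in> I \<and> \<mu> i = m} = {}"
      by blast
    then show ?thesis
      by (simp only: sum.empty)
  qed
qed

text \<open>Traversing an edge backwards contributes the inverse, in agreement with the sign in the class of the path.\<close>

lemma parallel_transport:
  assumes "\<Phi> \<in> connections \<Gamma>" "set L \<subseteq> D"
  shows "prod_list (map \<Phi> L) = \<T> (loop_class L) \<Phi>"
  using assms(2)
proof (induction L)
  case (Cons d L)
  obtain f s where d: "d = (f, s)" and f: "f \<in> E"
    using Cons.prems by (auto simp: oriented_edges_def)
  have "\<T> (loop_class [d]) \<Phi> = (\<Prod>e\<in>E. if e = f then \<Phi> (e, True) powi (if s then 1 else - 1) else 1)"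
    unfolding edge_character_def d by (intro prod.cong refl) simp
  also have "\<dots> = \<Phi> d"
    using f finite_edges connection_reverse[OF assms(1) f] by (simp add: d power_int_minus)
  finally have "\<T> (loop_class [d]) \<Phi> = \<Phi> d" .
  moreover have "loop_class (d # L) = (\<lambda>e. loop_class [d] e + loop_class L e)"
    by (simp add: d fun_eq_iff)
  ultimately show ?case
    using Cons edge_character_add[OF assms(1), of "loop_class [d]" "loop_class L"] by simp
qed (simp add: edge_character_zero)

text \<open>The monodromy of a loop depends on its homology class only.\<close>

lemma monodromy_eq_class_character:
  assumes "set L \<subseteq> D" "loop_class L \<in> cycles"
  shows "monodromy \<Gamma> L = \<W> (loop_class L)"
proof (rule extensionalityI[of _ "line_bundles \<Gamma>"])
  fix l assume l: "l \<in> line_bundles \<Gamma>"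
  then obtain \<Phi> where \<Phi>: "\<Phi> \<in> connections \<Gamma>" "l = bundle_of \<Phi>"
    by (rule line_bundle_cases)
  have "prod_list (map \<Psi> L) = \<T> (loop_class L) \<Phi>" if "\<Psi> \<in> l" for \<Psi>
  proof -
    have "(\<Phi>, \<Psi>) \<in> gauge_equivalence \<Gamma>"
      using that \<Phi>(2) by simp
    then show ?thesis
      using parallel_transport[OF _ assms(1), of \<Psi>] edge_character_invariant[OF assms(2)]
      by (auto simp: gauge_equivalence_def)
  qed
  moreover have "l \<noteq> {}"
    using gauge_equivalence_refl \<Phi> by blast
  ultimately have "(\<lambda>\<Psi>. prod_list (map \<Psi> L)) ` l = {\<T> (loop_class L) \<Phi>}"
    by auto
  then show "monodromy \<Gamma> L l = \<W> (loop_class L) l"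
    using l \<Phi> assms(2) by (simp add: monodromy_def class_character_bundle_of)
qed (simp_all add: monodromy_def class_character_extensional)

end

section \<open>The algebra of regular functions\<close>

context bipartite_ribbon_graph
begin

abbreviation "R \<equiv> regular_functions \<Gamma>"
abbreviation "LB \<equiv> line_bundles \<Gamma>"

lemma regular_functions_simps:
  "carrier R = {f. regular_function \<Gamma> f}"
  "f \<otimes>\<^bsub>R\<^esub> g = (\<lambda>l\<in>LB. f l * g l)"
  "\<one>\<^bsub>R\<^esub> = (\<lambda>l\<in>LB. 1)"
  "\<zero>\<^bsub>R\<^esub> = (\<lambda>l\<in>LB. 0)"
  "f \<oplus>\<^bsub>R\<^esub> g = (\<lambda>l\<in>LB. f l + g l)"
  "c \<odot>\<^bsub>R\<^esub> f = (\<lambda>l\<in>LB. c * f l)"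
  by (simp_all add: regular_functions_def)

text \<open>For a set \<open>M\<close> of cycles, the element of the group algebra of \<open>H\<^sub>1(\<Gamma>, \<int>)\<close> with coefficients \<open>a\<close>.\<close>

definition laurent_sum :: "('e \<Rightarrow> int) set \<Rightarrow> (('e \<Rightarrow> int) \<Rightarrow> complex) \<Rightarrow> 'e line_bundle_class \<Rightarrow> complex" where
  "laurent_sum M a = (\<lambda>l\<in>LB. \<Sum>m\<in>M. a m * \<W> m l)"

lemma source_target_in_vertices:
  assumes "d \<in> D"
  shows "source \<Gamma> d \<in> V" "target \<Gamma> d \<in> V"
  using assms ends_in_vertices by (auto simp: oriented_edges_def source_def target_def reverse_edge_def)

lemma gauge_equivalence_equiv: "equiv (connections \<Gamma>) (gauge_equivalence \<Gamma>)"
proof (rule equivI)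
  show "gauge_equivalence \<Gamma> \<subseteq> connections \<Gamma> \<times> connections \<Gamma>"
    by (auto simp: gauge_equivalence_def)
  show "refl_on (connections \<Gamma>) (gauge_equivalence \<Gamma>)"
    using gauge_equivalence_refl by (simp add: refl_on_def)
  show "sym (gauge_equivalence \<Gamma>)"
  proof (rule symI)
    fix \<Phi> \<Psi> assume "(\<Phi>, \<Psi>) \<in> gauge_equivalence \<Gamma>"
    then obtain g where g: "\<forall>v\<in>V. g v \<noteq> 0"
      "\<forall>d\<in>D. \<Psi> d = g (target \<Gamma> d) * \<Phi> d / g (source \<Gamma> d)"
      and conn: "\<Phi> \<in> connections \<Gamma>" "\<Psi> \<in> connections \<Gamma>"
      unfolding gauge_equivalence_def by blast
    have "\<exists>h. (\<forall>v\<in>V. h v \<noteq> 0) \<and> (\<forall>d\<in>D. \<Phi> d = h (target \<Gamma> d) * \<Psi> d / h (source \<Gamma> d))"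
      using g source_target_in_vertices by (intro exI[of _ "\<lambda>v. inverse (g v)"]) (simp add: field_simps)
    then show "(\<Psi>, \<Phi>) \<in> gauge_equivalence \<Gamma>"
      using conn by (simp add: gauge_equivalence_def)
  qed
  show "trans (gauge_equivalence \<Gamma>)"
  proof (rule transI)
    fix \<Phi> \<Psi> \<Xi> assume "(\<Phi>, \<Psi>) \<in> gauge_equivalence \<Gamma>" "(\<Psi>, \<Xi>) \<in> gauge_equivalence \<Gamma>"
    then obtain g h where g: "\<forall>v\<in>V. g v \<noteq> 0"
      "\<forall>d\<in>D. \<Psi> d = g (target \<Gamma> d) * \<Phi> d / g (source \<Gamma> d)"
      and h: "\<forall>v\<in>V. h v \<noteq> 0"
      "\<forall>d\<in>D. \<Xi> d = h (target \<Gamma> d) * \<Psi> d / h (source \<Gamma> d)"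
      and conn: "\<Phi> \<in> connections \<Gamma>" "\<Xi> \<in> connections \<Gamma>"
      unfolding gauge_equivalence_def by blast
    have "\<exists>k. (\<forall>v\<in>V. k v \<noteq> 0) \<and> (\<forall>d\<in>D. \<Xi> d = k (target \<Gamma> d) * \<Phi> d / k (source \<Gamma> d))"
      using g h source_target_in_vertices by (intro exI[of _ "\<lambda>v. h v * g v"]) (simp add: ac_simps)
    then show "(\<Phi>, \<Xi>) \<in> gauge_equivalence \<Gamma>"
      using conn by (simp add: gauge_equivalence_def)
  qed
qed

text \<open>Rescaling the line at a single vertex detects the boundary of a chain at that vertex.\<close>

lemma gauge_at_vertex:
  assumes \<Phi>: "\<Phi> \<in> connections \<Gamma>" and v: "v \<in> V"
  obtains \<Psi> where "\<Psi> \<in> connections \<Gamma>" "bundle_of \<Psi> = bundle_of \<Phi>"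
    "\<And>m. \<T> m \<Psi> = 2 powi ((if v \<in> black \<Gamma> then - 1 else 1) * (\<Sum>e\<in>edges_at \<Gamma> v. m e)) * \<T> m \<Phi>"
proof -
  define g :: "'s \<Rightarrow> complex" where "g u = (if u = v then 2 else 1)" for u
  let ?\<Psi> = "connection_of \<Gamma> (\<lambda>e. g (w e) * \<Phi> (e, True) / g (b e))"
  have equiv: "(\<Phi>, ?\<Psi>) \<in> gauge_equivalence \<Gamma>"
    using \<Phi> by (intro gauge_transform) (simp_all add: g_def)
  show ?thesis
  proof (rule that[of ?\<Psi>])
    show "?\<Psi> \<in> connections \<Gamma>"
      using equiv by (simp add: gauge_equivalence_def)
    show "bundle_of ?\<Psi> = bundle_of \<Phi>"
      using equiv_class_eq[OF gauge_equivalence_equiv equiv] by simp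
    fix m :: "'e \<Rightarrow> int"
    let ?s = "\<lambda>u. (if u \<in> black \<Gamma> then - 1 else 1) * (\<Sum>e\<in>edges_at \<Gamma> u. m e)"
    have "\<T> m ?\<Psi> = (\<Prod>u\<in>V. g u powi ?s u) * \<T> m \<Phi>"
      by (rule edge_character_gauge) (simp_all add: g_def connection_of_def oriented_edges_def)
    also have "(\<Prod>u\<in>V. g u powi ?s u) = (\<Prod>u\<in>V. if u = v then 2 powi ?s u else 1)"
      by (intro prod.cong refl) (simp add: g_def)
    also have "\<dots> = 2 powi ?s v"
      using v finite_vertices by (simp only: prod.delta if_True)
    finally show "\<T> m ?\<Psi> = 2 powi ?s v * \<T> m \<Phi>" .
  qed
qed

text \<open>Compare the coefficients of a gauge transform with the original ones: a character whose index has
  nonzero boundary at \<open>v\<close> is multiplied by a nontrivial constant.\<close>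

lemma gauge_invariant_laurent_polynomial:
  assumes "finite M" and supp: "\<And>m e. m \<in> M \<Longrightarrow> e \<notin> E \<Longrightarrow> m e = 0"
    and f: "\<And>\<Phi>. \<Phi> \<in> connections \<Gamma> \<Longrightarrow> f (bundle_of \<Phi>) = (\<Sum>m\<in>M. a m * \<T> m \<Phi>)"
    and m: "m \<in> M" "m \<notin> cycles"
  shows "a m = 0"
proof -
  obtain v where v: "v \<in> V" "(\<Sum>e\<in>edges_at \<Gamma> v. m e) \<noteq> 0"
    using m supp unfolding cycles_def by blast
  define c :: "('e \<Rightarrow> int) \<Rightarrow> complex"
    where "c m = 2 powi ((if v \<in> black \<Gamma> then - 1 else 1) * (\<Sum>e\<in>edges_at \<Gamma> v. m e))" for m
  have "\<forall>m\<in>M. a m * (c m - 1) = 0"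
  proof (rule edge_characters_independent[of M "\<lambda>m. a m * (c m - 1)"])
    fix \<Phi> assume \<Phi>: "\<Phi> \<in> connections \<Gamma>"
    obtain \<Psi> where \<Psi>: "\<Psi> \<in> connections \<Gamma>" "bundle_of \<Psi> = bundle_of \<Phi>"
      and T: "\<And>m. \<T> m \<Psi> = c m * \<T> m \<Phi>"
      using gauge_at_vertex[OF \<Phi> v(1)] unfolding c_def by metis
    have "(\<Sum>m\<in>M. a m * (c m - 1) * \<T> m \<Phi>) = (\<Sum>m\<in>M. a m * \<T> m \<Psi>) - (\<Sum>m\<in>M. a m * \<T> m \<Phi>)"
      by (simp add: T algebra_simps flip: sum_subtractf)
    also have "\<dots> = 0"
      using f[OF \<Phi>] f[OF \<Psi>(1)] \<Psi>(2) by simp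
    finally show "(\<Sum>m\<in>M. a m * (c m - 1) * \<T> m \<Phi>) = 0" .
  qed (use assms(1) supp in auto)
  then have "a m * (c m - 1) = 0"
    using m(1) by blast
  moreover have "c m \<noteq> 2 powi 0"
    unfolding c_def two_powi_inject using v(2) by simp
  ultimately show ?thesis
    by simp
qed

lemma regular_function_laurent_sum:
  assumes "finite M" "M \<subseteq> cycles"
  shows "regular_function \<Gamma> (laurent_sum M a)"
proof -
  have "laurent_sum M a (bundle_of \<Phi>) = (\<Sum>m\<in>M. a m * (\<Prod>e\<in>E. \<Phi> (e, True) powi m e))"
    if "\<Phi> \<in> connections \<Gamma>" for \<Phi>
    unfolding laurent_sum_def restrict_apply if_P[OF bundle_of_line_bundle[OF that]]
    using assms(2) that by (intro sum.cong refl) (auto simp: class_character_bundle_of edge_character_def)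
  then show ?thesis
    using assms(1) unfolding regular_function_def by (auto simp: laurent_sum_def)
qed

lemma laurent_sum_reindex:
  assumes "finite I"
  shows "(\<lambda>l\<in>LB. \<Sum>i\<in>I. a i * \<W> (\<mu> i) l) = laurent_sum (\<mu> ` I) (\<lambda>m. \<Sum>i | i \<in> I \<and> \<mu> i = m. a i)"
  unfolding laurent_sum_def
proof (rule restrict_ext)
  fix l
  have "(\<Sum>i\<in>I. a i * \<W> (\<mu> i) l) = (\<Sum>m\<in>\<mu> ` I. \<Sum>i | i \<in> I \<and> \<mu> i = m. a i * \<W> (\<mu> i) l)"
    by (rule sum.image_gen[OF assms])
  also have "\<dots> = (\<Sum>m\<in>\<mu> ` I. (\<Sum>i | i \<in> I \<and> \<mu> i = m. a i) * \<W> m l)"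
    by (intro sum.cong refl) (simp add: sum_distrib_right)
  finally show "(\<Sum>i\<in>I. a i * \<W> (\<mu> i) l) = (\<Sum>m\<in>\<mu> ` I. (\<Sum>i | i \<in> I \<and> \<mu> i = m. a i) * \<W> m l)" .
qed

lemma regular_functionI:
  assumes "finite I" "\<And>i. i \<in> I \<Longrightarrow> \<mu> i \<in> cycles"
    and "f \<in> extensional LB" "\<And>l. l \<in> LB \<Longrightarrow> f l = (\<Sum>i\<in>I. a i * \<W> (\<mu> i) l)"
  shows "f \<in> carrier R"
proof -
  have "f = (\<lambda>l\<in>LB. \<Sum>i\<in>I. a i * \<W> (\<mu> i) l)"
    using assms(3,4) by (intro extensionalityI[of f LB]) auto
  then show ?thesis
    unfolding laurent_sum_reindex[OF assms(1)] regular_functions_simps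
    using regular_function_laurent_sum[of "\<mu> ` I"] assms(1,2) by (simp add: image_subset_iff)
qed

text \<open>Merging the monomials that agree on all edges, the expansion becomes unique, and gauge invariance leaves only the
  monomials indexed by cycles.\<close>

lemma regular_function_cases:
  assumes "f \<in> carrier R"
  obtains M a where "finite M" "M \<subseteq> cycles" "f = laurent_sum M a"
proof -
  from assms have ext: "f \<in> extensional LB"
    by (simp add: regular_functions_simps regular_function_def)
  from assms obtain M :: "('e \<Rightarrow> int) set" and a where M: "finite M"
    and f: "\<forall>\<Phi>\<in>connections \<Gamma>. f (bundle_of \<Phi>) = (\<Sum>m\<in>M. a m * (\<Prod>e\<in>E. \<Phi> (e, True) powi m e))"
    unfolding regular_functions_simps regular_function_def by blast
  \<comment> \<open>Exponents that agree on the edges give the same character; this picks one of them.\<close>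
  define r where "r m e = (if e \<in> E then m e else (0 :: int))" for m e
  define a' where "a' k = (\<Sum>m | m \<in> M \<and> r m = k. a m)" for k
  have f': "f (bundle_of \<Phi>) = (\<Sum>k\<in>r ` M. a' k * \<T> k \<Phi>)" if "\<Phi> \<in> connections \<Gamma>" for \<Phi>
  proof -
    have "f (bundle_of \<Phi>) = (\<Sum>m\<in>M. a m * \<T> (r m) \<Phi>)"
      using f that by (simp add: edge_character_def r_def)
    also have "\<dots> = (\<Sum>k\<in>r ` M. \<Sum>m | m \<in> M \<and> r m = k. a m * \<T> (r m) \<Phi>)"
      by (rule sum.image_gen[OF M])
    also have "\<dots> = (\<Sum>k\<in>r ` M. a' k * \<T> k \<Phi>)"
      by (intro sum.cong refl) (simp add: a'_def sum_distrib_right)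
    finally show ?thesis .
  qed
  have zero: "a' k = 0" if "k \<in> r ` M" "k \<notin> cycles" for k
    using that M f' by (intro gauge_invariant_laurent_polynomial[of "r ` M" f a' k]) (auto simp: r_def)
  have "f = laurent_sum (r ` M \<inter> cycles) a'"
  proof (rule extensionalityI[OF ext])
    fix l assume l: "l \<in> LB"
    then obtain \<Phi> where \<Phi>: "\<Phi> \<in> connections \<Gamma>" "l = bundle_of \<Phi>"
      by (rule line_bundle_cases)
    have "f l = (\<Sum>k\<in>r ` M. a' k * \<T> k \<Phi>)"
      using f' \<Phi> by simp
    also have "\<dots> = (\<Sum>k\<in>r ` M \<inter> cycles. a' k * \<T> k \<Phi>)"
      using M zero by (intro sum.mono_neutral_right) auto
    also have "\<dots> = laurent_sum (r ` M \<inter> cycles) a' l"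
      using l \<Phi> by (simp add: laurent_sum_def class_character_bundle_of)
    finally show "f l = laurent_sum (r ` M \<inter> cycles) a' l" .
  qed (simp add: laurent_sum_def)
  then show ?thesis
    using M by (intro that[of "r ` M \<inter> cycles" a']) auto
qed

lemma regular_extensional: "f \<in> carrier R \<Longrightarrow> f \<in> extensional LB"
  by (simp add: regular_functions_simps regular_function_def)

lemma class_character_regular: "m \<in> cycles \<Longrightarrow> \<W> m \<in> carrier R"
  by (rule regular_functionI[of "{m}" "\<lambda>m. m" _ "\<lambda>m. 1"]) (simp_all add: class_character_extensional)

lemma smult_regular:
  assumes "f \<in> carrier R"
  shows "c \<odot>\<^bsub>R\<^esub> f \<in> carrier R"
proof -
  obtain M a where "finite M" "M \<subseteq> cycles" "f = laurent_sum M a"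
    using regular_function_cases[OF assms] .
  then show ?thesis
    by (intro regular_functionI[of M "\<lambda>m. m" _ "\<lambda>m. c * a m"])
      (auto simp: regular_functions_simps laurent_sum_def sum_distrib_left mult.assoc)
qed

lemma add_regular:
  assumes "f \<in> carrier R" "g \<in> carrier R"
  shows "f \<oplus>\<^bsub>R\<^esub> g \<in> carrier R"
proof -
  obtain M a where f: "finite M" "M \<subseteq> cycles" "f = laurent_sum M a"
    using regular_function_cases[OF assms(1)] .
  obtain N c where g: "finite N" "N \<subseteq> cycles" "g = laurent_sum N c"
    using regular_function_cases[OF assms(2)] .
  show ?thesis
  proof (rule regular_functionI[of "M <+> N" "case_sum (\<lambda>m. m) (\<lambda>m. m)" _ "case_sum a c"])
    fix l assume "l \<in> LB"
    then show "(f \<oplus>\<^bsub>R\<^esub> g) l = (\<Sum>i\<in>M <+> N. case_sum a c i * \<W> (case_sum (\<lambda>m. m) (\<lambda>m. m) i) l)"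
      using f g by (simp add: regular_functions_simps laurent_sum_def sum.Plus)
  qed (use f g in \<open>auto simp: regular_functions_simps\<close>)
qed

lemma mult_regular:
  assumes "f \<in> carrier R" "g \<in> carrier R"
  shows "f \<otimes>\<^bsub>R\<^esub> g \<in> carrier R"
proof -
  obtain M a where f: "finite M" "M \<subseteq> cycles" "f = laurent_sum M a"
    using regular_function_cases[OF assms(1)] .
  obtain N c where g: "finite N" "N \<subseteq> cycles" "g = laurent_sum N c"
    using regular_function_cases[OF assms(2)] .
  show ?thesis
  proof (rule regular_functionI[of "M \<times> N" "\<lambda>(m, n) e. m e + n e" _ "\<lambda>(m, n). a m * c n"])
    fix l assume l: "l \<in> LB"
    then have "(f \<otimes>\<^bsub>R\<^esub> g) l = (\<Sum>(m, n)\<in>M \<times> N. (a m * \<W> m l) * (c n * \<W> n l))"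
      using f g by (simp add: regular_functions_simps laurent_sum_def sum_product sum.cartesian_product)
    also have "\<dots> = (\<Sum>(m, n)\<in>M \<times> N. a m * c n * \<W> (\<lambda>e. m e + n e) l)"
      using f(2) g(2) l by (intro sum.cong refl) (auto simp: class_character_add subset_iff)
    finally show "(f \<otimes>\<^bsub>R\<^esub> g) l = (\<Sum>i\<in>M \<times> N. (case i of (m, n) \<Rightarrow> a m * c n) * \<W> (case i of (m, n) \<Rightarrow> \<lambda>e. m e + n e) l)"
      by (simp add: case_prod_beta)
  qed (use f g in \<open>auto simp: regular_functions_simps intro!: add_cycles\<close>)
qed

lemma one_regular: "\<one>\<^bsub>R\<^esub> \<in> carrier R"
  by (rule regular_functionI[of "{\<lambda>e. 0}" "\<lambda>m. m" _ "\<lambda>m. 1"])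
    (simp_all add: regular_functions_simps zero_cycle class_character_zero)

lemma zero_regular: "\<zero>\<^bsub>R\<^esub> \<in> carrier R"
  by (rule regular_functionI[of "{}" "\<lambda>m. m" _ "\<lambda>m. 1"]) (simp_all add: regular_functions_simps)

lemma cring_regular_functions: "cring R"
proof (rule cringI)
  show "abelian_group R"
  proof (rule abelian_groupI)
    fix f assume f: "f \<in> carrier R"
    show "\<zero>\<^bsub>R\<^esub> \<oplus>\<^bsub>R\<^esub> f = f"
      using regular_extensional[OF f] by (intro extensionalityI[of _ LB]) (auto simp: regular_functions_simps)
    show "\<exists>g\<in>carrier R. g \<oplus>\<^bsub>R\<^esub> f = \<zero>\<^bsub>R\<^esub>"
      using smult_regular[OF f, of "- 1"]
      by (intro bexI[of _ "(- 1) \<odot>\<^bsub>R\<^esub> f"]) (auto simp: regular_functions_simps fun_eq_iff restrict_def)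
  next
    fix f g h
    show "(f \<oplus>\<^bsub>R\<^esub> g) \<oplus>\<^bsub>R\<^esub> h = f \<oplus>\<^bsub>R\<^esub> (g \<oplus>\<^bsub>R\<^esub> h)" "f \<oplus>\<^bsub>R\<^esub> g = g \<oplus>\<^bsub>R\<^esub> f"
      by (auto simp: regular_functions_simps fun_eq_iff restrict_def)
  qed (simp_all add: add_regular zero_regular)
  show "comm_monoid R"
  proof (rule comm_monoidI)
    fix f assume f: "f \<in> carrier R"
    show "\<one>\<^bsub>R\<^esub> \<otimes>\<^bsub>R\<^esub> f = f"
      using regular_extensional[OF f] by (intro extensionalityI[of _ LB]) (auto simp: regular_functions_simps)
  next
    fix f g h
    show "(f \<otimes>\<^bsub>R\<^esub> g) \<otimes>\<^bsub>R\<^esub> h = f \<otimes>\<^bsub>R\<^esub> (g \<otimes>\<^bsub>R\<^esub> h)" "f \<otimes>\<^bsub>R\<^esub> g = g \<otimes>\<^bsub>R\<^esub> f"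
      by (auto simp: regular_functions_simps fun_eq_iff restrict_def)
  qed (simp_all add: mult_regular one_regular)
  show "(f \<oplus>\<^bsub>R\<^esub> g) \<otimes>\<^bsub>R\<^esub> h = f \<otimes>\<^bsub>R\<^esub> h \<oplus>\<^bsub>R\<^esub> g \<otimes>\<^bsub>R\<^esub> h" for f g h
    by (auto simp: regular_functions_simps fun_eq_iff restrict_def algebra_simps)
qed

end

section \<open>The center of the Poisson algebra\<close>

context bipartite_ribbon_graph
begin

lemma int_multiple_cycles: "m \<in> cycles \<Longrightarrow> (\<lambda>e. k * m e) \<in> cycles"
  by (simp add: cycles_def flip: sum_distrib_left)

lemma sum_cycles: "(\<And>i. i \<in> I \<Longrightarrow> \<mu> i \<in> cycles) \<Longrightarrow> (\<lambda>e. \<Sum>i\<in>I. \<mu> i e) \<in> cycles"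
  by (induction I rule: infinite_finite_induct) (simp_all add: zero_cycle add_cycles)

lemma zigzag_class_cycle: "Z \<in> \<Z> \<Longrightarrow> zigzag_class Z \<in> cycles"
  using zigzag_sum_cycle zigzag_sum_single by metis

lemma zigzag_monodromy_eq:
  assumes "Z \<in> \<Z>"
  shows "zigzag_monodromy \<Gamma> rib Z = \<W> (zigzag_class Z)"
proof -
  have "\<exists>L. zigzag_path \<Gamma> rib L \<and> set L = Z"
    using assms by (auto simp: zigzag_loops_def)
  from someI_ex[OF this] have L: "zigzag_path \<Gamma> rib (SOME L. zigzag_path \<Gamma> rib L \<and> set L = Z)"
    "set (SOME L. zigzag_path \<Gamma> rib L \<and> set L = Z) = Z"
    by simp_all
  show ?thesis
    unfolding zigzag_monodromy_def
    using monodromy_eq_class_character[of "SOME L. zigzag_path \<Gamma> rib L \<and> set L = Z"]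
      loop_class_zigzag_path[OF L(1)] L(2) zigzag_loop_subset[OF assms] zigzag_class_cycle[OF assms]
    by simp
qed

lemma class_character_power:
  assumes "m \<in> cycles" "l \<in> LB"
  shows "\<W> (\<lambda>e. int k * m e) l = \<W> m l ^ k"
proof (induction k)
  case (Suc k)
  have "\<W> (\<lambda>e. int (Suc k) * m e) l = \<W> (\<lambda>e. m e + int k * m e) l"
    by (simp add: algebra_simps)
  then show ?case
    using Suc class_character_add[OF assms(1) int_multiple_cycles[OF assms(1)] assms(2)] by simp
qed (simp add: class_character_zero assms(2))

lemma class_character_sum:
  assumes "finite I" "\<And>i. i \<in> I \<Longrightarrow> \<mu> i \<in> cycles" "l \<in> LB"
  shows "\<W> (\<lambda>e. \<Sum>i\<in>I. \<mu> i e) l = (\<Prod>i\<in>I. \<W> (\<mu> i) l)"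
  using assms(1,2)
proof (induction I rule: finite_induct)
  case (insert i I)
  then show ?case
    using class_character_add[of "\<mu> i" "\<lambda>e. \<Sum>i\<in>I. \<mu> i e" l] sum_cycles[of I \<mu>] assms(3) by simp
qed (simp add: class_character_zero assms(3))

lemma zigzag_monomial:
  assumes "l \<in> LB"
  shows "\<W> (zigzag_sum (\<lambda>Z. int (p Z))) l = (\<Prod>Z\<in>\<Z>. zigzag_monodromy \<Gamma> rib Z l ^ p Z)"
proof -
  have "\<W> (zigzag_sum (\<lambda>Z. int (p Z))) l = (\<Prod>Z\<in>\<Z>. \<W> (\<lambda>e. int (p Z) * zigzag_class Z e) l)"
    unfolding zigzag_sum_def[abs_def]
    using finite_zigzag_loops zigzag_class_cycle assms by (intro class_character_sum int_multiple_cycles) auto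
  also have "\<dots> = (\<Prod>Z\<in>\<Z>. zigzag_monodromy \<Gamma> rib Z l ^ p Z)"
    using assms by (intro prod.cong refl) (simp add: zigzag_monodromy_eq zigzag_class_cycle class_character_power)
  finally show ?thesis .
qed

lemma prod_zigzag_monodromy:
  assumes "l \<in> LB"
  shows "(\<Prod>Z\<in>\<Z>. zigzag_monodromy \<Gamma> rib Z l) = 1"
  using zigzag_monomial[OF assms, of "\<lambda>Z. 1"] zigzag_sum_const[of 1] class_character_zero[OF assms] by simp

lemma zigzag_monodromy_regular: "Z \<in> \<Z> \<Longrightarrow> zigzag_monodromy \<Gamma> rib Z \<in> carrier R"
  by (simp add: zigzag_monodromy_eq class_character_regular zigzag_class_cycle)

lemma finprod_regular_functions:
  assumes "finite I" "\<And>i. i \<in> I \<Longrightarrow> f i \<in> carrier R"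
  shows "finprod R f I = (\<lambda>l\<in>LB. \<Prod>i\<in>I. f i l)"
proof -
  interpret cring R
    by (rule cring_regular_functions)
  show ?thesis
    using assms
  proof (induction I rule: finite_induct)
    case empty
    show ?case
      by (simp add: regular_functions_simps(3))
  next
    case (insert i I)
    then have "finprod R f (insert i I) = f i \<otimes>\<^bsub>R\<^esub> finprod R f I"
      by (intro finprod_insert) auto
    then show ?case
      using insert by (auto simp: regular_functions_simps(2) fun_eq_iff restrict_def)
  qed
qed

lemma finprod_zigzag_monodromy: "finprod R (zigzag_monodromy \<Gamma> rib) \<Z> = \<one>\<^bsub>R\<^esub>"
  using finprod_regular_functions[OF finite_zigzag_loops, of "zigzag_monodromy \<Gamma> rib"] zigzag_monodromy_regular
  by (auto simp: regular_functions_simps(3) prod_zigzag_monodromy intro!: restrict_ext)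

abbreviation "zigzag_algebra \<equiv> generated_subalgebra R (zigzag_monodromy \<Gamma> rib ` \<Z>)"

lemma zigzag_algebra_intros:
  shows "Z \<in> \<Z> \<Longrightarrow> zigzag_monodromy \<Gamma> rib Z \<in> zigzag_algebra"
    and "(\<lambda>l\<in>LB. c) \<in> zigzag_algebra"
    and "f \<in> zigzag_algebra \<Longrightarrow> g \<in> zigzag_algebra \<Longrightarrow> (\<lambda>l\<in>LB. f l + g l) \<in> zigzag_algebra"
    and "f \<in> zigzag_algebra \<Longrightarrow> g \<in> zigzag_algebra \<Longrightarrow> (\<lambda>l\<in>LB. f l * g l) \<in> zigzag_algebra"
proof -
  show "Z \<in> \<Z> \<Longrightarrow> zigzag_monodromy \<Gamma> rib Z \<in> zigzag_algebra"
    unfolding generated_subalgebra_def by (intro generate_ring.incl) blast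
  have "c \<odot>\<^bsub>R\<^esub> \<one>\<^bsub>R\<^esub> = (\<lambda>l\<in>LB. c)"
    by (auto simp: regular_functions_simps fun_eq_iff restrict_def)
  then show "(\<lambda>l\<in>LB. c) \<in> zigzag_algebra"
    unfolding generated_subalgebra_def by (intro generate_ring.incl) (metis UnI1 rangeI)
  show "f \<in> zigzag_algebra \<Longrightarrow> g \<in> zigzag_algebra \<Longrightarrow> (\<lambda>l\<in>LB. f l + g l) \<in> zigzag_algebra"
    unfolding generated_subalgebra_def using generate_ring.eng_add[of f R _ g]
    by (simp only: regular_functions_simps(5))
  show "f \<in> zigzag_algebra \<Longrightarrow> g \<in> zigzag_algebra \<Longrightarrow> (\<lambda>l\<in>LB. f l * g l) \<in> zigzag_algebra"
    unfolding generated_subalgebra_def using generate_ring.eng_mult[of f R _ g]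
    by (simp only: regular_functions_simps(2))
qed

lemma zigzag_algebra_monomial: "(\<lambda>l\<in>LB. \<Prod>Z\<in>\<Z>. zigzag_monodromy \<Gamma> rib Z l ^ p Z) \<in> zigzag_algebra"
proof -
  have power: "(\<lambda>l\<in>LB. zigzag_monodromy \<Gamma> rib Z l ^ k) \<in> zigzag_algebra" if Z: "Z \<in> \<Z>" for Z k
  proof (induction k)
    case 0
    show ?case
      using zigzag_algebra_intros(2)[of 1] by (simp only: power_0)
  next
    case (Suc k)
    have "(\<lambda>l\<in>LB. zigzag_monodromy \<Gamma> rib Z l * (\<lambda>l\<in>LB. zigzag_monodromy \<Gamma> rib Z l ^ k) l) =
        (\<lambda>l\<in>LB. zigzag_monodromy \<Gamma> rib Z l ^ Suc k)"
      by (intro restrict_ext) simp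
    with zigzag_algebra_intros(4)[OF zigzag_algebra_intros(1)[OF Z] Suc] show ?case
      by (simp only:)
  qed
  have "(\<lambda>l\<in>LB. \<Prod>Z\<in>F. zigzag_monodromy \<Gamma> rib Z l ^ p Z) \<in> zigzag_algebra" if "F \<subseteq> \<Z>" for F
    using finite_subset[OF that finite_zigzag_loops] that
  proof (induction F rule: finite_induct)
    case empty
    show ?case
      using zigzag_algebra_intros(2)[of 1] by (simp only: prod.empty)
  next
    case (insert Z F)
    then have rest: "(\<lambda>l\<in>LB. \<Prod>Z\<in>F. zigzag_monodromy \<Gamma> rib Z l ^ p Z) \<in> zigzag_algebra" and Z: "Z \<in> \<Z>"
      by blast+
    have "(\<lambda>l\<in>LB. (\<lambda>l\<in>LB. zigzag_monodromy \<Gamma> rib Z l ^ p Z) l * (\<lambda>l\<in>LB. \<Prod>Z\<in>F. zigzag_monodromy \<Gamma> rib Z l ^ p Z) l) =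
        (\<lambda>l\<in>LB. \<Prod>Z\<in>insert Z F. zigzag_monodromy \<Gamma> rib Z l ^ p Z)"
      using insert.hyps by (intro restrict_ext) simp
    with zigzag_algebra_intros(4)[OF power[OF Z, of "p Z"] rest] show ?case
      by (simp only:)
  qed
  then show ?thesis
    by blast
qed

text \<open>A constant may be added to all coefficients, as the classes of the zig-zag loops add up to zero; a sufficiently large one
  makes all exponents nonnegative.\<close>

lemma zigzag_algebra_character: "\<W> (zigzag_sum n) \<in> zigzag_algebra"
proof -
  \<comment> \<open>An upper bound for all \<open>- n Z\<close>.\<close>
  define k where "k = (\<Sum>Z\<in>\<Z>. \<bar>n Z\<bar>)"
  have "n Z + k \<ge> 0" if "Z \<in> \<Z>" for Z
  proof -
    have "\<bar>n Z\<bar> \<le> k"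
      unfolding k_def using that finite_zigzag_loops by (intro member_le_sum) auto
    then show ?thesis
      by linarith
  qed
  then have "zigzag_sum (\<lambda>Z. int (nat (n Z + k))) = zigzag_sum (\<lambda>Z. n Z + k)"
    unfolding zigzag_sum_def[abs_def] by (intro ext sum.cong refl) simp
  also have "\<dots> = zigzag_sum n"
    using zigzag_sum_const[of k] by (simp add: fun_eq_iff zigzag_sum_add)
  finally have "\<W> (zigzag_sum n) = (\<lambda>l\<in>LB. \<Prod>Z\<in>\<Z>. zigzag_monodromy \<Gamma> rib Z l ^ nat (n Z + k))"
    using zigzag_monomial[of _ "\<lambda>Z. nat (n Z + k)"]
    by (intro extensionalityI[of _ LB]) (simp_all add: class_character_extensional)
  then show ?thesis
    using zigzag_algebra_monomial by simp
qed

lemma zigzag_algebra_laurent_sum: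
  assumes "finite M" "M \<subseteq> range zigzag_sum"
  shows "laurent_sum M a \<in> zigzag_algebra"
  using assms
proof (induction M rule: finite_induct)
  case empty
  show ?case
    using zigzag_algebra_intros(2)[of 0] by (simp only: laurent_sum_def sum.empty)
next
  case (insert m M)
  then obtain n where m: "m = zigzag_sum n"
    by blast
  have "(\<lambda>l\<in>LB. (\<lambda>l\<in>LB. (\<lambda>l\<in>LB. a m) l * \<W> m l) l + laurent_sum M a l) \<in> zigzag_algebra"
    using insert by (intro zigzag_algebra_intros) (auto simp: m intro: zigzag_algebra_character)
  also have "(\<lambda>l\<in>LB. (\<lambda>l\<in>LB. (\<lambda>l\<in>LB. a m) l * \<W> m l) l + laurent_sum M a l) = laurent_sum (insert m M) a"
    using insert.hyps by (auto simp: laurent_sum_def fun_eq_iff restrict_def)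
  finally show ?case .
qed

context
  fixes B :: "('e line_bundle_class \<Rightarrow> complex) \<Rightarrow> ('e line_bundle_class \<Rightarrow> complex) \<Rightarrow> 'e line_bundle_class \<Rightarrow> complex"
  assumes bracket: "surface_graph_bracket \<Gamma> rib B"
begin

lemma bracket_poisson: "poisson_bracket R B"
  using bracket by (simp add: surface_graph_bracket_def)

lemma bracket_closed: "f \<in> carrier R \<Longrightarrow> g \<in> carrier R \<Longrightarrow> B f g \<in> carrier R"
  using bracket_poisson unfolding poisson_bracket_def by blast

lemma bracket_linear:
  assumes "f \<in> carrier R" "g \<in> carrier R" "h \<in> carrier R" "l \<in> LB"
  shows "B (c \<odot>\<^bsub>R\<^esub> f \<oplus>\<^bsub>R\<^esub> g) h l = c * B f h l + B g h l"
proof -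
  have "B (c \<odot>\<^bsub>R\<^esub> f \<oplus>\<^bsub>R\<^esub> g) h = c \<odot>\<^bsub>R\<^esub> B f h \<oplus>\<^bsub>R\<^esub> B g h"
    using bracket_poisson assms unfolding poisson_bracket_def by blast
  then show ?thesis
    using assms(4) by (simp add: regular_functions_simps)
qed

lemma bracket_antisymmetric:
  assumes "f \<in> carrier R" "g \<in> carrier R" "l \<in> LB"
  shows "B f g l = - B g f l"
proof -
  have "(B f g \<oplus>\<^bsub>R\<^esub> B g f) l = \<zero>\<^bsub>R\<^esub> l"
    using bracket_poisson assms unfolding poisson_bracket_def by metis
  then show ?thesis
    using assms(3) by (simp add: regular_functions_simps add_eq_0_iff)
qed

lemma bracket_leibniz:
  assumes "f \<in> carrier R" "g \<in> carrier R" "h \<in> carrier R" "l \<in> LB"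
  shows "B f (g \<otimes>\<^bsub>R\<^esub> h) l = B f g l * h l + g l * B f h l"
proof -
  have "B f (g \<otimes>\<^bsub>R\<^esub> h) = B f g \<otimes>\<^bsub>R\<^esub> h \<oplus>\<^bsub>R\<^esub> g \<otimes>\<^bsub>R\<^esub> B f h"
    using bracket_poisson assms unfolding poisson_bracket_def by blast
  then show ?thesis
    using assms(4) by (simp add: regular_functions_simps)
qed

lemma bracket_zero:
  assumes "h \<in> carrier R" "l \<in> LB"
  shows "B \<zero>\<^bsub>R\<^esub> h l = 0"
proof -
  have "1 \<odot>\<^bsub>R\<^esub> \<zero>\<^bsub>R\<^esub> \<oplus>\<^bsub>R\<^esub> \<zero>\<^bsub>R\<^esub> = \<zero>\<^bsub>R\<^esub>"
    by (auto simp: regular_functions_simps fun_eq_iff restrict_def)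
  with bracket_linear[OF zero_regular zero_regular assms, of 1] show ?thesis
    by simp
qed

text \<open>Every cycle is the class of one loop, so the prescribed bracket of loop monodromies determines this bracket at once.\<close>

lemma bracket_characters:
  assumes "m \<in> cycles" "m' \<in> cycles" "l \<in> LB"
  shows "B (\<W> m) (\<W> m') l = of_rat (pairing m m') * \<W> (\<lambda>e. m e + m' e) l"
proof -
  obtain L where L: "oriented_loop \<Gamma> L" "loop_class L = m"
    using cycle_is_loop_class[OF assms(1)] by blast
  obtain L' where L': "oriented_loop \<Gamma> L'" "loop_class L' = m'"
    using cycle_is_loop_class[OF assms(2)] by blast
  have "monodromy \<Gamma> L = \<W> m" "monodromy \<Gamma> L' = \<W> m'"
    using monodromy_eq_class_character L L' assms by (auto simp: oriented_loop_def)
  moreover have "B (monodromy \<Gamma> L) (monodromy \<Gamma> L') =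
      of_rat (pairing (loop_class L) (loop_class L')) \<odot>\<^bsub>R\<^esub> (monodromy \<Gamma> L \<otimes>\<^bsub>R\<^esub> monodromy \<Gamma> L')"
    using bracket L(1) L'(1) unfolding surface_graph_bracket_def by blast
  ultimately show ?thesis
    using L(2) L'(2) assms by (simp add: regular_functions_simps class_character_add)
qed

lemma bracket_laurent_sum:
  assumes "finite M" "M \<subseteq> cycles" "h \<in> carrier R" "l \<in> LB"
  shows "B (laurent_sum M a) h l = (\<Sum>m\<in>M. a m * B (\<W> m) h l)"
  using assms(1,2)
proof (induction M rule: finite_induct)
  case empty
  have "laurent_sum {} a = \<zero>\<^bsub>R\<^esub>"
    by (simp add: laurent_sum_def regular_functions_simps)
  then show ?case
    using bracket_zero assms by simp
next
  case (insert m M)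
  have "laurent_sum (insert m M) a = a m \<odot>\<^bsub>R\<^esub> \<W> m \<oplus>\<^bsub>R\<^esub> laurent_sum M a"
    using insert.hyps by (auto simp: laurent_sum_def regular_functions_simps fun_eq_iff restrict_def)
  moreover have "laurent_sum M a \<in> carrier R"
    using insert regular_function_laurent_sum[of M a] by (simp add: regular_functions_simps)
  ultimately show ?case
    using insert assms(3,4) bracket_linear[of "\<W> m" "laurent_sum M a" h l "a m"]
    by (simp add: class_character_regular)
qed

lemma center_iff: "f \<in> poisson_center R B \<longleftrightarrow> f \<in> carrier R \<and> (\<forall>g\<in>carrier R. \<forall>l\<in>LB. B f g l = 0)"
proof -
  have "B f g = \<zero>\<^bsub>R\<^esub> \<longleftrightarrow> (\<forall>l\<in>LB. B f g l = 0)" if "f \<in> carrier R" "g \<in> carrier R" for g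
  proof -
    have "B f g = \<zero>\<^bsub>R\<^esub>" if zero: "\<forall>l\<in>LB. B f g l = 0"
      using regular_extensional[OF bracket_closed[OF \<open>f \<in> carrier R\<close> \<open>g \<in> carrier R\<close>]] zero
      by (intro extensionalityI[of _ LB]) (simp_all add: regular_functions_simps)
    then show ?thesis
      by (auto simp: regular_functions_simps)
  qed
  then show ?thesis
    unfolding poisson_center_def by blast
qed

text \<open>The bracket with \<open>\<W> m'\<close> moves the index \<open>m\<close> to \<open>m + m'\<close>, so different terms cannot cancel, and each index with nonzero
  coefficient lies in the radical of the pairing.\<close>

lemma central_laurent_sum:
  assumes "f \<in> poisson_center R B"
  obtains M a where "finite M" "M \<subseteq> range zigzag_sum" "f = laurent_sum M a"
proof -
  have f: "f \<in> carrier R" and central: "\<And>g l. g \<in> carrier R \<Longrightarrow> l \<in> LB \<Longrightarrow> B f g l = 0"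
    using assms by (auto simp: center_iff)
  obtain M a where M: "finite M" "M \<subseteq> cycles" and f_eq: "f = laurent_sum M a"
    using regular_function_cases[OF f] .
  have orth: "a m = 0 \<or> pairing m m' = 0" if m: "m \<in> M" and m': "m' \<in> cycles" for m m'
  proof -
    have "(\<Sum>k\<in>M. (a k * of_rat (pairing k m')) * \<W> (\<lambda>e. k e + m' e) l) = 0" if l: "l \<in> LB" for l
    proof -
      have "(\<Sum>k\<in>M. (a k * of_rat (pairing k m')) * \<W> (\<lambda>e. k e + m' e) l) = (\<Sum>k\<in>M. a k * B (\<W> k) (\<W> m') l)"
        using M(2) m' l by (intro sum.cong refl) (auto simp: bracket_characters)
      also have "\<dots> = B f (\<W> m') l"
        unfolding f_eq using bracket_laurent_sum[OF M class_character_regular[OF m'] l] by simp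
      also have "\<dots> = 0"
        using central class_character_regular[OF m'] l by blast
      finally show ?thesis .
    qed
    then have "(\<Sum>k | k \<in> M \<and> (\<lambda>e. k e + m' e) = (\<lambda>e. m e + m' e). a k * of_rat (pairing k m')) = 0"
      using M m' by (intro class_characters_independent) (auto intro: add_cycles)
    also have "{k. k \<in> M \<and> (\<lambda>e. k e + m' e) = (\<lambda>e. m e + m' e)} = {m}"
      using m by (auto simp: fun_eq_iff)
    finally show ?thesis
      by simp
  qed
  define M' where "M' = {m \<in> M. a m \<noteq> 0}"
  have sub: "M' \<subseteq> range zigzag_sum"
  proof
    fix m assume m: "m \<in> M'"
    then have "m \<in> cycles" "\<And>m'. m' \<in> cycles \<Longrightarrow> pairing m m' = 0"
      using M(2) orth unfolding M'_def by auto
    from radical_is_zigzag_sum[OF this] show "m \<in> range zigzag_sum"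
      by blast
  qed
  have eq: "f = laurent_sum M' a"
    unfolding f_eq laurent_sum_def M'_def using M(1)
    by (intro restrict_ext sum.mono_neutral_right) auto
  have fin: "finite M'"
    unfolding M'_def using M(1) by simp
  show ?thesis
    by (rule that[OF fin sub eq])
qed

lemma laurent_sum_central:
  assumes "finite M" "M \<subseteq> range zigzag_sum"
  shows "laurent_sum M a \<in> poisson_center R B"
  unfolding center_iff
proof (intro conjI ballI)
  have M: "M \<subseteq> cycles"
    using assms(2) zigzag_sum_cycle by blast
  show "laurent_sum M a \<in> carrier R"
    using regular_function_laurent_sum[OF assms(1) M] by (simp add: regular_functions_simps)
  fix g l assume g: "g \<in> carrier R" and l: "l \<in> LB"
  obtain N c where N: "finite N" "N \<subseteq> cycles" and g_eq: "g = laurent_sum N c"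
    using regular_function_cases[OF g] .
  have "B (\<W> m) g l = 0" if m: "m \<in> M" for m
  proof -
    have "m \<in> cycles" and m_regular: "\<W> m \<in> carrier R"
      using m M class_character_regular by auto
    have "B (\<W> k) (\<W> m) l = 0" if k: "k \<in> N" for k
    proof -
      have k_cycle: "k \<in> cycles"
        using k N(2) by blast
      obtain n where "m = zigzag_sum n"
        using assms(2) m by blast
      then have "pairing m k = 0"
        using zigzag_sum_radical[OF k_cycle] by simp
      then have "B (\<W> m) (\<W> k) l = 0"
        using bracket_characters[OF \<open>m \<in> cycles\<close> k_cycle l] by simp
      then show ?thesis
        using bracket_antisymmetric[OF class_character_regular[OF k_cycle] m_regular l] by simp
    qed
    then have "B g (\<W> m) l = 0"
      unfolding g_eq using bracket_laurent_sum[OF N m_regular l] by simp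
    then show ?thesis
      using bracket_antisymmetric[OF m_regular g l] by simp
  qed
  then show "B (laurent_sum M a) g l = 0"
    using bracket_laurent_sum[OF assms(1) M g l] by simp
qed

text \<open>One inclusion expands a central function in characters; for the other, the center is a subalgebra by bilinearity and the
  Leibniz rule.\<close>

lemma center_eq_zigzag_algebra: "poisson_center R B = zigzag_algebra"
proof
  show "poisson_center R B \<subseteq> zigzag_algebra"
  proof
    fix f assume "f \<in> poisson_center R B"
    then obtain M a where "finite M" "M \<subseteq> range zigzag_sum" "f = laurent_sum M a"
      by (rule central_laurent_sum)
    then show "f \<in> zigzag_algebra"
      by (simp only: zigzag_algebra_laurent_sum)
  qed
  show "zigzag_algebra \<subseteq> poisson_center R B"
  proof
    fix f assume "f \<in> zigzag_algebra"
    then show "f \<in> poisson_center R B"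
      unfolding generated_subalgebra_def
    proof (induction f rule: generate_ring.induct)
      case one
      have "laurent_sum {zigzag_sum (\<lambda>Z. 0)} (\<lambda>m. 1) = \<one>\<^bsub>R\<^esub>"
        unfolding zigzag_sum_const by (auto simp: laurent_sum_def regular_functions_simps class_character_zero fun_eq_iff restrict_def)
      then show ?case
        using laurent_sum_central[of "{zigzag_sum (\<lambda>Z. 0)}" "\<lambda>m. 1"] by simp
    next
      case (incl f)
      then consider c where "f = c \<odot>\<^bsub>R\<^esub> \<one>\<^bsub>R\<^esub>" | Z where "Z \<in> \<Z>" "f = zigzag_monodromy \<Gamma> rib Z"
        by blast
      then show ?case
      proof cases
        case 1
        then have "laurent_sum {zigzag_sum (\<lambda>Z. 0)} (\<lambda>m. c) = f"
          unfolding zigzag_sum_const by (auto simp: laurent_sum_def regular_functions_simps class_character_zero fun_eq_iff restrict_def)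
        then show ?thesis
          using laurent_sum_central[of "{zigzag_sum (\<lambda>Z. 0)}" "\<lambda>m. c"] by simp
      next
        case 2
        then have "laurent_sum {zigzag_class Z} (\<lambda>m. 1) = f"
          by (auto simp: laurent_sum_def zigzag_monodromy_eq fun_eq_iff restrict_def class_character_def)
        moreover have "zigzag_class Z \<in> range zigzag_sum"
          unfolding zigzag_sum_single[OF 2(1), symmetric] by (rule rangeI)
        ultimately show ?thesis
          using laurent_sum_central[of "{zigzag_class Z}" "\<lambda>m. 1"] by simp
      qed
    next
      case (a_inv f)
      interpret cring R
        by (rule cring_regular_functions)
      have f: "f \<in> carrier R"
        using a_inv by (simp add: center_iff)
      have "1 \<odot>\<^bsub>R\<^esub> f \<oplus>\<^bsub>R\<^esub> (\<ominus>\<^bsub>R\<^esub> f) = f \<oplus>\<^bsub>R\<^esub> (\<ominus>\<^bsub>R\<^esub> f)"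
        by (auto simp: regular_functions_simps fun_eq_iff restrict_def)
      then have "1 \<odot>\<^bsub>R\<^esub> f \<oplus>\<^bsub>R\<^esub> (\<ominus>\<^bsub>R\<^esub> f) = \<zero>\<^bsub>R\<^esub>"
        using f r_neg by simp
      then show ?case
        using a_inv.IH f bracket_linear[of f "\<ominus>\<^bsub>R\<^esub> f" _ _ 1] bracket_zero
        by (simp add: center_iff)
    next
      case (eng_add f g)
      then have f: "f \<in> carrier R" and g: "g \<in> carrier R"
        by (simp_all add: center_iff)
      have "f \<oplus>\<^bsub>R\<^esub> g = 1 \<odot>\<^bsub>R\<^esub> f \<oplus>\<^bsub>R\<^esub> g"
        by (auto simp: regular_functions_simps fun_eq_iff restrict_def)
      then show ?case
        using eng_add.IH add_regular[OF f g] bracket_linear[OF f g, of _ _ 1]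
        by (simp add: center_iff)
    next
      case (eng_mult f g)
      then have f: "f \<in> carrier R" and g: "g \<in> carrier R"
        by (simp_all add: center_iff)
      have "B (f \<otimes>\<^bsub>R\<^esub> g) h l = 0" if h: "h \<in> carrier R" and l: "l \<in> LB" for h l
      proof -
        have "B h f l = 0" "B h g l = 0"
          using eng_mult.IH h l bracket_antisymmetric[OF h f l] bracket_antisymmetric[OF h g l]
          by (simp_all add: center_iff)
        then show ?thesis
          using bracket_antisymmetric[OF mult_regular[OF f g] h l] bracket_leibniz[OF h f g l] by simp
      qed
      then show ?case
        using mult_regular[OF f g] by (simp add: center_iff)
    qed
  qed
qed

end
end

section \<open>Polynomials in several variables\<close>

definition monomial_value :: "('z \<Rightarrow> complex) \<Rightarrow> ('z \<Rightarrow>\<^sub>0 nat) \<Rightarrow> complex" where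
  "monomial_value x m = (\<Prod>z\<in>Poly_Mapping.keys m. x z ^ Poly_Mapping.lookup m z)"

text \<open>The exponent of the product of all variables.\<close>

definition all_ones :: "'z set \<Rightarrow> 'z \<Rightarrow>\<^sub>0 nat" where
  "all_ones X = (\<Sum>z\<in>X. Poly_Mapping.single z 1)"

text \<open>The ideal generated by the relation that the product of all variables is 1.\<close>

definition product_relations :: "'z set \<Rightarrow> 'z polynomial set" where
  "product_relations X = {((\<Prod>z\<in>X. variable z) - 1) * Q | Q. Q \<in> polynomials_in X}"

lemma monomial_value_superset:
  assumes "finite X" "Poly_Mapping.keys m \<subseteq> X"
  shows "monomial_value x m = (\<Prod>z\<in>X. x z ^ Poly_Mapping.lookup m z)"
  unfolding monomial_value_def using assms
  by (intro prod.mono_neutral_left) (auto simp: in_keys_iff)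

lemma monomial_value_add: "monomial_value x (m + n) = monomial_value x m * monomial_value x n"
proof -
  let ?X = "Poly_Mapping.keys m \<union> Poly_Mapping.keys n"
  have "monomial_value x (m + n) = (\<Prod>z\<in>?X. x z ^ Poly_Mapping.lookup (m + n) z)"
    by (rule monomial_value_superset) (auto simp: Poly_Mapping.keys_add)
  also have "\<dots> = (\<Prod>z\<in>?X. x z ^ Poly_Mapping.lookup m z) * (\<Prod>z\<in>?X. x z ^ Poly_Mapping.lookup n z)"
    by (simp add: lookup_add power_add prod.distrib)
  also have "\<dots> = monomial_value x m * monomial_value x n"
    using monomial_value_superset[of ?X m x] monomial_value_superset[of ?X n x] by simp
  finally show ?thesis .
qed

lemma evaluate_superset:
  assumes "finite A" "Poly_Mapping.keys P \<subseteq> A"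
  shows "evaluate x P = (\<Sum>m\<in>A. Poly_Mapping.lookup P m * monomial_value x m)"
  unfolding evaluate_def monomial_value_def[symmetric] using assms
  by (intro sum.mono_neutral_left) (auto simp: in_keys_iff)

lemma evaluate_add: "evaluate x (P + Q) = evaluate x P + evaluate x Q"
proof -
  let ?A = "Poly_Mapping.keys P \<union> Poly_Mapping.keys Q"
  have "evaluate x (P + Q) = (\<Sum>m\<in>?A. Poly_Mapping.lookup (P + Q) m * monomial_value x m)"
    by (rule evaluate_superset) (auto simp: Poly_Mapping.keys_add)
  also have "\<dots> = evaluate x P + evaluate x Q"
    using evaluate_superset[of ?A P x] evaluate_superset[of ?A Q x]
    by (simp add: lookup_add distrib_right sum.distrib)
  finally show ?thesis .
qed

lemma evaluate_single: "evaluate x (Poly_Mapping.single m c) = c * monomial_value x m"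
  using evaluate_superset[of "{m}" "Poly_Mapping.single m c" x] by simp

lemma evaluate_zero: "evaluate x 0 = 0"
  by (simp add: evaluate_def)

lemma evaluate_one: "evaluate x 1 = 1"
  using evaluate_single[of x 0 1] by (simp add: monomial_value_def)

lemma evaluate_diff: "evaluate x (P - Q) = evaluate x P - evaluate x Q"
  using evaluate_add[of x "P - Q" Q] by simp

lemma polynomial_induct [case_names zero add]:
  assumes "p 0" and "\<And>m c P. p P \<Longrightarrow> p (Poly_Mapping.single m c + P)"
  shows "p (P :: 'z polynomial)"
proof (induction P rule: Poly_Mapping.update_induct)
  case const
  show ?case by (fact assms(1))
next
  case (update P m c)
  have "Poly_Mapping.update m c P = Poly_Mapping.single m c + P"
    using update(1) by (intro poly_mapping_eqI) (auto simp: lookup_update lookup_add lookup_single in_keys_iff when_def)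
  then show ?case
    using assms(2)[OF update(3)] by simp
qed

lemma evaluate_mult: "evaluate x (P * Q) = evaluate x P * evaluate x Q"
proof (induction P rule: polynomial_induct)
  case (add m c P)
  have "evaluate x (Poly_Mapping.single m c * Q) = c * monomial_value x m * evaluate x Q"
  proof (induction Q rule: polynomial_induct)
    case (add n d Q)
    then show ?case
      by (simp add: distrib_left mult_single evaluate_add evaluate_single monomial_value_add algebra_simps)
  qed (simp add: evaluate_zero)
  with add show ?case
    by (simp add: distrib_right evaluate_add evaluate_single)
qed (simp add: evaluate_zero)

lemma evaluate_prod_variables:
  assumes "finite X"
  shows "evaluate x (\<Prod>z\<in>X. variable z) = (\<Prod>z\<in>X. x z)"
  using assms
  by (induction X rule: finite_induct)
    (simp_all add: evaluate_one evaluate_mult variable_def evaluate_single monomial_value_def)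

lemma prod_variables:
  assumes "finite X"
  shows "(\<Prod>z\<in>X. variable z) = Poly_Mapping.single (all_ones X) 1"
  using assms unfolding all_ones_def
  by (induction X rule: finite_induct) (simp_all add: variable_def mult_single)

lemma lookup_all_ones: "finite X \<Longrightarrow> Poly_Mapping.lookup (all_ones X) z = (if z \<in> X then 1 else 0)"
  by (simp add: all_ones_def lookup_sum lookup_single when_def)

lemma polynomials_in_zero: "0 \<in> polynomials_in X"
  by (simp add: polynomials_in_def)

lemma polynomials_in_add: "P \<in> polynomials_in X \<Longrightarrow> Q \<in> polynomials_in X \<Longrightarrow> P + Q \<in> polynomials_in X"
  using Poly_Mapping.keys_add[of P Q] by (auto simp: polynomials_in_def)

lemma polynomials_in_uminus: "P \<in> polynomials_in X \<Longrightarrow> - P \<in> polynomials_in X"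
  by (simp add: polynomials_in_def)

lemma polynomials_in_single: "Poly_Mapping.keys m \<subseteq> X \<Longrightarrow> Poly_Mapping.single m c \<in> polynomials_in X"
  by (simp add: polynomials_in_def)

lemma polynomials_in_mult:
  assumes "P \<in> polynomials_in X" "Q \<in> polynomials_in X"
  shows "P * Q \<in> polynomials_in X"
  unfolding polynomials_in_def
proof (intro CollectI ballI)
  fix k assume "k \<in> Poly_Mapping.keys (P * Q)"
  then obtain m n where "m \<in> Poly_Mapping.keys P" "n \<in> Poly_Mapping.keys Q" "k = m + n"
    using Poly_Mapping.keys_mult[of P Q] by blast
  then show "Poly_Mapping.keys k \<subseteq> X"
    using assms Poly_Mapping.keys_add[of m n] unfolding polynomials_in_def by blast
qed

lemma product_relations_subset:
  assumes "finite X" "P \<in> product_relations X"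
  shows "P \<in> polynomials_in X"
proof -
  have "Poly_Mapping.keys (all_ones X) \<subseteq> X"
    using assms(1) by (auto simp: in_keys_iff lookup_all_ones split: if_splits)
  then have "Poly_Mapping.single (all_ones X) 1 + - Poly_Mapping.single 0 1 \<in> polynomials_in X"
    by (intro polynomials_in_add polynomials_in_uminus polynomials_in_single) auto
  then have "(\<Prod>z\<in>X. variable z) - 1 \<in> polynomials_in X"
    by (simp add: prod_variables[OF assms(1)])
  then show ?thesis
    using assms(2) polynomials_in_mult unfolding product_relations_def by blast
qed

lemma product_relations_zero: "0 \<in> product_relations X"
  using polynomials_in_zero unfolding product_relations_def by force

lemma product_relations_add:
  assumes "P \<in> product_relations X" "P' \<in> product_relations X"
  shows "P + P' \<in> product_relations X"
proof -
  obtain Q Q' where "P = ((\<Prod>z\<in>X. variable z) - 1) * Q" "Q \<in> polynomials_in X"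
    "P' = ((\<Prod>z\<in>X. variable z) - 1) * Q'" "Q' \<in> polynomials_in X"
    using assms unfolding product_relations_def by blast
  then have "P + P' = ((\<Prod>z\<in>X. variable z) - 1) * (Q + Q')" "Q + Q' \<in> polynomials_in X"
    by (simp_all add: distrib_left polynomials_in_add)
  then show ?thesis
    unfolding product_relations_def by blast
qed

lemma product_relations_uminus:
  assumes "P \<in> product_relations X"
  shows "- P \<in> product_relations X"
proof -
  obtain Q where "P = ((\<Prod>z\<in>X. variable z) - 1) * Q" "Q \<in> polynomials_in X"
    using assms unfolding product_relations_def by blast
  then have "- P = ((\<Prod>z\<in>X. variable z) - 1) * (- Q)" "- Q \<in> polynomials_in X"
    by (simp_all add: polynomials_in_uminus)
  then show ?thesis
    unfolding product_relations_def by blast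
qed

text \<open>Modulo the ideal, multiplication of a monomial by the product of all variables has no effect.\<close>

lemma single_shift_relation:
  assumes "finite X" "Poly_Mapping.keys m \<subseteq> X" "Poly_Mapping.keys n \<subseteq> X"
    and "\<And>z. z \<in> X \<Longrightarrow> Poly_Mapping.lookup n z = Poly_Mapping.lookup m z + k"
  shows "Poly_Mapping.single n c - Poly_Mapping.single m c \<in> product_relations X"
  using assms(3,4)
proof (induction k arbitrary: n)
  case 0
  then have "n = m"
    using assms(2) by (intro poly_mapping_eqI) (metis add_0_right in_keys_iff subsetD)
  then show ?case
    by (simp add: product_relations_zero)
next
  case (Suc k)
  define n' where "n' = n - all_ones X"
  have lookup_n': "Poly_Mapping.lookup n' z = Poly_Mapping.lookup m z + k" if "z \<in> X" for z
    using Suc.prems(2)[OF that] that assms(1) by (simp add: n'_def lookup_minus lookup_all_ones)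
  have keys_n': "Poly_Mapping.keys n' \<subseteq> X"
    using Suc.prems(1) by (auto simp: n'_def in_keys_iff lookup_minus)
  have n: "n = all_ones X + n'"
  proof (rule poly_mapping_eqI)
    fix z show "Poly_Mapping.lookup n z = Poly_Mapping.lookup (all_ones X + n') z"
      using Suc.prems(2)[of z] assms(1)
      by (auto simp: n'_def lookup_add lookup_minus lookup_all_ones)
  qed
  have "Poly_Mapping.single n c - Poly_Mapping.single n' c =
      ((\<Prod>z\<in>X. variable z) - 1) * Poly_Mapping.single n' c"
    by (simp add: prod_variables[OF assms(1)] n left_diff_distrib mult_single)
  then have "Poly_Mapping.single n c - Poly_Mapping.single n' c \<in> product_relations X"
    using polynomials_in_single[OF keys_n'] unfolding product_relations_def by blast
  from product_relations_add[OF this Suc.IH[OF keys_n' lookup_n']] show ?case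
    by simp
qed

context bipartite_ribbon_graph
begin

lemma evaluate_product_relation:
  assumes "P \<in> product_relations \<Z>" "l \<in> LB"
  shows "evaluate (\<lambda>Z. zigzag_monodromy \<Gamma> rib Z l) P = 0"
  using assms unfolding product_relations_def
  by (auto simp: evaluate_mult evaluate_diff evaluate_one evaluate_prod_variables finite_zigzag_loops prod_zigzag_monodromy)

lemma evaluate_zigzag_monodromy:
  assumes "P \<in> polynomials_in \<Z>" "l \<in> LB"
  shows "evaluate (\<lambda>Z. zigzag_monodromy \<Gamma> rib Z l) P =
    (\<Sum>m\<in>Poly_Mapping.keys P. Poly_Mapping.lookup P m * \<W> (zigzag_sum (\<lambda>Z. int (Poly_Mapping.lookup m Z))) l)"
  unfolding evaluate_def monomial_value_def[symmetric]
proof (intro sum.cong refl)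
  fix m assume "m \<in> Poly_Mapping.keys P"
  then have "Poly_Mapping.keys m \<subseteq> \<Z>"
    using assms(1) by (simp add: polynomials_in_def)
  then show "Poly_Mapping.lookup P m * monomial_value (\<lambda>Z. zigzag_monodromy \<Gamma> rib Z l) m =
      Poly_Mapping.lookup P m * \<W> (zigzag_sum (\<lambda>Z. int (Poly_Mapping.lookup m Z))) l"
    using monomial_value_superset[OF finite_zigzag_loops] zigzag_monomial[OF assms(2)] by simp
qed

text \<open>Equal characters have exponents that differ by a constant \<open>k\<close>; its sign decides which of the two monomials is
  a multiple of the other.\<close>

lemma equal_characters_relation:
  assumes keys: "Poly_Mapping.keys m \<subseteq> \<Z>" "Poly_Mapping.keys n \<subseteq> \<Z>"
    and eq: "zigzag_sum (\<lambda>Z. int (Poly_Mapping.lookup m Z)) = zigzag_sum (\<lambda>Z. int (Poly_Mapping.lookup n Z))"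
  shows "Poly_Mapping.single m c - Poly_Mapping.single n c \<in> product_relations \<Z>"
proof -
  let ?d = "\<lambda>Z. int (Poly_Mapping.lookup m Z) - int (Poly_Mapping.lookup n Z)"
  have "zigzag_sum ?d e = 0" for e
    by (simp add: zigzag_sum_diff eq)
  then have "\<exists>k. \<forall>Z\<in>\<Z>. ?d Z = k"
    using zigzag_sum_eq_zero[of ?d] by blast
  then obtain k where k: "\<And>Z. Z \<in> \<Z> \<Longrightarrow> ?d Z = k"
    by blast
  show ?thesis
  proof (cases "k \<ge> 0")
    case True
    then have "Poly_Mapping.lookup m Z = Poly_Mapping.lookup n Z + nat k" if "Z \<in> \<Z>" for Z
      using k[OF that] by linarith
    then show ?thesis
      using single_shift_relation[OF finite_zigzag_loops keys(2,1)] by blast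
  next
    case False
    then have "Poly_Mapping.lookup n Z = Poly_Mapping.lookup m Z + nat (- k)" if "Z \<in> \<Z>" for Z
      using k[OF that] by linarith
    then have "Poly_Mapping.single n c - Poly_Mapping.single m c \<in> product_relations \<Z>"
      using single_shift_relation[OF finite_zigzag_loops keys(1,2)] by blast
    from product_relations_uminus[OF this] show ?thesis
      by simp
  qed
qed

text \<open>By independence of characters, a monomial \<open>m\<close> of a relation shares its character with another
  monomial \<open>n\<close>. Moving the coefficient from \<open>m\<close> to \<open>n\<close> changes the polynomial by an element of the ideal and shortens it.\<close>

lemma relation_is_product_relation:
  assumes "P \<in> polynomials_in \<Z>"
    and "\<And>l. l \<in> LB \<Longrightarrow> evaluate (\<lambda>Z. zigzag_monodromy \<Gamma> rib Z l) P = 0"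
  shows "P \<in> product_relations \<Z>"
  using assms
proof (induction "card (Poly_Mapping.keys P)" arbitrary: P rule: less_induct)
  case less
  show ?case
  proof (cases "P = 0")
    case True
    then show ?thesis
      by (simp add: product_relations_zero)
  next
    case False
    then obtain m where m: "m \<in> Poly_Mapping.keys P"
      by (metis ex_in_conv keys_eq_empty)
    define c where "c = Poly_Mapping.lookup P m"
    define \<mu> where "\<mu> n = zigzag_sum (\<lambda>Z. int (Poly_Mapping.lookup n Z))" for n
    have "(\<Sum>n | n \<in> Poly_Mapping.keys P \<and> \<mu> n = \<mu> m. Poly_Mapping.lookup P n) = 0"
    proof (rule class_characters_independent)
      show "(\<Sum>n\<in>Poly_Mapping.keys P. Poly_Mapping.lookup P n * \<W> (\<mu> n) l) = 0" if "l \<in> LB" for l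
        using less.prems(2)[OF that] evaluate_zigzag_monodromy[OF less.prems(1) that] by (simp add: \<mu>_def)
    qed (simp_all add: \<mu>_def zigzag_sum_cycle)
    moreover have "c \<noteq> 0"
      using m by (simp add: c_def in_keys_iff)
    ultimately have "{n \<in> Poly_Mapping.keys P. \<mu> n = \<mu> m} \<noteq> {m}"
      unfolding c_def by auto
    then obtain n where n: "n \<in> Poly_Mapping.keys P" "\<mu> n = \<mu> m" "n \<noteq> m"
      using m by blast
    let ?D = "Poly_Mapping.single m c - Poly_Mapping.single n c"
    have D: "?D \<in> product_relations \<Z>"
      using m n less.prems(1) by (intro equal_characters_relation) (auto simp: polynomials_in_def \<mu>_def)
    have "Poly_Mapping.keys (P - ?D) \<subseteq> Poly_Mapping.keys P - {m}"
      using m n by (auto simp: in_keys_iff lookup_minus lookup_single c_def when_def split: if_splits)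
    then have "card (Poly_Mapping.keys (P - ?D)) < card (Poly_Mapping.keys P)"
      using m by (intro psubset_card_mono) auto
    moreover have "P - ?D \<in> polynomials_in \<Z>"
      using polynomials_in_add[OF less.prems(1) polynomials_in_uminus[OF product_relations_subset[OF finite_zigzag_loops D]]]
      by (simp only: diff_conv_add_uminus)
    moreover have "evaluate (\<lambda>Z. zigzag_monodromy \<Gamma> rib Z l) (P - ?D) = 0" if "l \<in> LB" for l
      using less.prems(2)[OF that] evaluate_product_relation[OF D that] by (simp add: evaluate_diff)
    ultimately have "P - ?D \<in> product_relations \<Z>"
      by (rule less.hyps)
    from product_relations_add[OF this D] show ?thesis
      by simp
  qed
qed

lemma zigzag_relations:
  "{P \<in> polynomials_in \<Z>. \<forall>l\<in>LB. evaluate (\<lambda>Z. zigzag_monodromy \<Gamma> rib Z l) P = 0} = product_relations \<Z>"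
  using relation_is_product_relation evaluate_product_relation product_relations_subset[OF finite_zigzag_loops] by blast

end

section \<open>Zig-zag loops of bipartite surface graphs\<close>

lemma surface_graph_ribbon_graph:
  assumes "bipartite_surface_graph S \<A> \<Gamma>" "connected_graph \<Gamma>"
  shows "bipartite_ribbon_graph \<Gamma> (ccw_edges S \<A> \<Gamma>)"
proof
  fix v assume "v \<in> vertices \<Gamma>"
  then have "\<exists>es. ccw_order S \<A> \<Gamma> v es"
    using assms(1) unfolding bipartite_surface_graph_def by blast
  then have "ccw_order S \<A> \<Gamma> v (ccw_edges S \<A> \<Gamma> v)"
    unfolding ccw_edges_def by (rule someI_ex)
  then show "distinct (ccw_edges S \<A> \<Gamma> v)" "set (ccw_edges S \<A> \<Gamma> v) = edges_at \<Gamma> v"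
    unfolding ccw_order_def by blast+
qed (use assms in \<open>simp_all add: bipartite_surface_graph_def\<close>)

theorem lemma1p1:
  fixes S :: "'s topology" and \<A> :: "'s chart set" and \<Gamma> :: "('s, 'e) bipartite_graph"
    and bracket :: "('e line_bundle_class \<Rightarrow> complex) \<Rightarrow> ('e line_bundle_class \<Rightarrow> complex) \<Rightarrow>
      ('e line_bundle_class \<Rightarrow> complex)"
  assumes "compact_oriented_surface S \<A>"
    and "bipartite_surface_graph S \<A> \<Gamma>"
    and "connected_graph \<Gamma>"
    and "surface_graph_bracket \<Gamma> (ccw_edges S \<A> \<Gamma>) bracket"
  shows "poisson_center (regular_functions \<Gamma>) bracket =
           generated_subalgebra (regular_functions \<Gamma>)
             (zigzag_monodromy \<Gamma> (ccw_edges S \<A> \<Gamma>) ` zigzag_loops \<Gamma> (ccw_edges S \<A> \<Gamma>)) \<and>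
         (\<Otimes>\<^bsub>regular_functions \<Gamma>\<^esub> Z \<in> zigzag_loops \<Gamma> (ccw_edges S \<A> \<Gamma>).
             zigzag_monodromy \<Gamma> (ccw_edges S \<A> \<Gamma>) Z) = \<one>\<^bsub>regular_functions \<Gamma>\<^esub> \<and>
         {P \<in> polynomials_in (zigzag_loops \<Gamma> (ccw_edges S \<A> \<Gamma>)).
            \<forall>l\<in>line_bundles \<Gamma>. evaluate (\<lambda>Z. zigzag_monodromy \<Gamma> (ccw_edges S \<A> \<Gamma>) Z l) P = 0} =
         {((\<Prod>Z\<in>zigzag_loops \<Gamma> (ccw_edges S \<A> \<Gamma>). variable Z) - 1) * Q | Q.
            Q \<in> polynomials_in (zigzag_loops \<Gamma> (ccw_edges S \<A> \<Gamma>))}"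
proof -
  interpret bipartite_ribbon_graph \<Gamma> "ccw_edges S \<A> \<Gamma>"
    using assms(2,3) by (rule surface_graph_ribbon_graph)
  show ?thesis
    by (intro conjI center_eq_zigzag_algebra[OF assms(4)] finprod_zigzag_monodromy
        zigzag_relations[unfolded product_relations_def])
qed

end
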